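(* Let $N\ge3$, let $\mu$ be the standard Bernoulli measure on $SG_N$, and let $u:SG_N\to\mathbb{R}$ be such that $\Delta_\mu u$ is continuous (that is, $u\in\operatorname{dom}\Delta_\mu$). Then the harmonic gradient $\nabla u(\omega)$ is defined for $\mu$-almost every $\omega\in\Omega$.
   Context: **Gasket.** Let $N\ge3$, $S=\{0,\dots,N-1\}$, let $p_0,\dots,p_{N-1}\in\mathbb{R}^{N-1}$ be the vertices of a regular simplex with $|p_j-p_k|=1$ for $j\ne k$, and $F_j(x)=\frac12(x-p_j)+p_j$. $SG_N$ is the unique non-empty compact set with $SG_N=\bigcup_{j=0}^{N-1}F_j(SG_N)$. For $w=w_1\cdots w_m\in S^m$ put $F_w=F_{w_1}\circ\cdots\circ F_{w_m}$. Let $V_0=\{p_0,\dots,p_{N-1}\}$, $V_m=\bigcup_{w\in S^m}F_w(V_0)$; for $x\neq y$ in $V_m$ write $x\sim_my$ if there is $w\in S^m$ with $x,y\in F_w(V_0)$. $\Omega=S^{\mathbb{N}}$ is the set of infinite words $\omega=\omega_1\omega_2\cdots$, and $[\omega]_n=\omega_1\cdots\omega_n$. **Energy.** For continuous $u,v$ on $SG_N$ let $\mathscr{E}_m(u,v)=\left(\frac{N+2}{N}\right)^m\sum_{x\sim_my}(u(x)-u(y))(v(x)-v(y))$ (sum over edges). $\mathscr{E}_m(u,u)$ is non-decreasing in $m$; put $\mathscr{E}(u,u)=\lim_m\mathscr{E}_m(u,u)$, $\operatorname{dom}\mathscr{E}=\{u:\mathscr{E}(u,u)<\infty\}$ (continuous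 functions), $\mathscr{E}(u,v)=\lim_m\mathscr{E}_m(u,v)$ on $\operatorname{dom}\mathscr{E}$; $\operatorname{dom}_0\mathscr{E}$ is the subspace of functions vanishing on $V_0$. **Measure and Laplacian.** The standard Bernoulli measure $\mu$ is the unique Borel probability measure on $SG_N$ with $\mu(A)=\frac1N\sum_{i=0}^{N-1}\mu(F_i^{-1}(A))$ for Borel $A$. It is the image, under the coding map $\omega\mapsto\bigcap_nF_{[\omega]_n}(SG_N)$, of the product measure on $\Omega=S^{\mathbb{N}}$ whose factors are uniform on $S$; this product measure is also denoted $\mu$, and "$\mu$-almost every $\omega\in\Omega$" refers to it. For $u\in\operatorname{dom}\mathscr{E}$ and $f$ continuous on $SG_N$, $u\in\operatorname{dom}\Delta_\mu$ with $\Delta_\mu u=f$ means $\mathscr{E}(u,v)=-\int_{SG_N}fv\,d\mu$ for all $v\in\operatorname{dom}_0\mathscr{E}$. **Harmonic functions and gradient.** $h\in\operatorname{dom}\mathscr{E}$ is harmonic if, among functions with the same values on $V_0$, it minimizes $\mathscr{E}_n$ for all $n\ge1$. Harmonic functions are uniquely determined by their (arbitrary) values on $V_0$; they form an $N$-dimensional space $\mathscr{H}$. If $h$ is harmonic so is $h\circ F_i$; let $A_i:\mathscr{H}\to\mathscr{H}$, $A_ih=h\circ F_i$ (in terms of boundary values $A_i$ is the harmonic extension matrix). Let $W\subset\mathscr{H}$ be the constants, $P:\mathscr{H}\to\tilde{\mathscr{H}}=\mathscr{H}/W$ the quotient map, and $\tilde A_i$ the induced map on $\tilde{\mathscr{H}}$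 with $\tilde A_i\circ P=P\circ A_i$; it is invertible. For $w=w_1\cdots w_m$, $\tilde A_w=\tilde A_{w_m}\cdots\tilde A_{w_1}$ is the map induced by $h\mapsto h\circ F_w$, and $\tilde A_w^{-1}$ is its inverse. $\tilde{\mathscr{H}}$ is a finite-dimensional Hilbert space with inner product induced by $\mathscr{E}$. For continuous $g$ let $H(g)$ be the harmonic function agreeing with $g$ on $V_0$, and $\tilde H(g)=PH(g)$. For $\omega\in\Omega$ set $\nabla_nf(\omega)=\tilde A^{-1}_{[\omega]_n}\tilde H(f\circ F_{[\omega]_n})$; the harmonic gradient $\nabla f(\omega)=\lim_{n\to\infty}\nabla_nf(\omega)$ is defined if the limit exists in $\tilde{\mathscr{H}}$. *)

theory Defs
  imports "HOL-Probability.Probability"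
begin

text \<open>
  A function on the gasket is represented by a total function on the ambient Euclidean space of
  which only the values on the gasket are used. The vertices of the simplex are
  \<open>p 0, \<dots>, p (N - 1)\<close>.
\<close>

definition regular_simplex :: "nat \<Rightarrow> (nat \<Rightarrow> 'a::euclidean_space) \<Rightarrow> bool" where
  "regular_simplex N p \<longleftrightarrow> DIM('a) = N - 1 \<and> (\<forall>j<N. \<forall>k<N. j \<noteq> k \<longrightarrow> dist (p j) (p k) = 1)"

definition F_map :: "(nat \<Rightarrow> 'a::euclidean_space) \<Rightarrow> nat \<Rightarrow> 'a \<Rightarrow> 'a" where
  "F_map p j x = (1/2) *\<^sub>R (x - p j) + p j"

fun F_word :: "(nat \<Rightarrow> 'a::euclidean_space) \<Rightarrow> nat list \<Rightarrow> 'a \<Rightarrow> 'a" where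
  "F_word p [] = id"
| "F_word p (i # w) = F_map p i \<circ> F_word p w"

definition is_gasket :: "nat \<Rightarrow> (nat \<Rightarrow> 'a::euclidean_space) \<Rightarrow> 'a set \<Rightarrow> bool" where
  "is_gasket N p K \<longleftrightarrow> K \<noteq> {} \<and> compact K \<and> K = (\<Union>j<N. F_map p j ` K)"

definition SG :: "nat \<Rightarrow> (nat \<Rightarrow> 'a::euclidean_space) \<Rightarrow> 'a set" where
  "SG N p = (THE K. is_gasket N p K)"

lemma dist_F_map: "dist (F_map p j x) (F_map p j y) = dist x y / 2"
proof -
  have "F_map p j x - F_map p j y = (1/2) *\<^sub>R (x - y)"
    by (simp add: F_map_def algebra_simps)
  then show ?thesis
    by (simp add: dist_norm)
qed

lemma continuous_on_F_map: "continuous_on A (F_map p j)"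
  unfolding F_map_def by (intro continuous_intros)

lemma is_gasket_subset:
  assumes K: "is_gasket N p K" and L: "is_gasket N p L"
  shows "K \<subseteq> L"
proof -
  have Kne: "K \<noteq> {}" "compact K" and Keq: "K = (\<Union>j<N. F_map p j ` K)"
    using K by (auto simp: is_gasket_def)
  have Lne: "L \<noteq> {}" "compact L" and Leq: "L = (\<Union>j<N. F_map p j ` L)"
    using L by (auto simp: is_gasket_def)
  have "continuous_on K (\<lambda>x. infdist x L)"
    by (intro continuous_intros)
  then obtain x where x: "x \<in> K" "\<And>y. y \<in> K \<Longrightarrow> infdist y L \<le> infdist x L"
    using continuous_attains_sup[OF Kne(2,1)] by blast
  obtain j y where jy: "j < N" "y \<in> K" "x = F_map p j y"
    using x(1) Keq by blast
  obtain z where z: "z \<in> L" "infdist y L = dist y z"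
    using infdist_attains_inf[of L y] Lne compact_imp_closed by blast
  have "F_map p j z \<in> L"
    using Leq z(1) jy(1) by blast
  then have "infdist x L \<le> dist x (F_map p j z)"
    by (rule infdist_le)
  also have "\<dots> = infdist y L / 2"
    by (simp add: jy(3) dist_F_map z(2))
  also have "\<dots> \<le> infdist x L / 2"
    using x(2)[OF jy(2)] by simp
  finally have "infdist x L \<le> 0"
    by simp
  then have "infdist y L = 0" if "y \<in> K" for y
    using x(2)[OF that] infdist_nonneg[of y L] by linarith
  then show ?thesis
    using Lne in_closed_iff_infdist_zero[of L] compact_imp_closed by blast
qed

lemma is_gasket_exists:
  assumes "N > 0"
  shows "\<exists>K. is_gasket N p K"
proof -
  define R where "R = (\<Sum>j<N. norm (p j))"
  have R: "norm (p j) \<le> R" if "j < N" for j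
    unfolding R_def by (rule member_le_sum) (use that in auto)
  have R0: "R \<ge> 0"
    unfolding R_def by (simp add: sum_nonneg)
  define C where "C n = ((\<lambda>K. \<Union>j<N. F_map p j ` K) ^^ n) (cball 0 R)" for n
  have C0: "C 0 = cball 0 R" and CS: "C (Suc n) = (\<Union>j<N. F_map p j ` C n)" for n
    by (simp_all add: C_def)
  have into: "F_map p j x \<in> cball 0 R" if "j < N" "x \<in> cball 0 R" for j x
  proof -
    have half: "(1/2) *\<^sub>R p j + (1/2) *\<^sub>R p j = p j"
      by (simp flip: scaleR_left_distrib)
    have "F_map p j x = (1/2) *\<^sub>R x - (1/2) *\<^sub>R p j + ((1/2) *\<^sub>R p j + (1/2) *\<^sub>R p j)"
      unfolding half by (simp add: F_map_def scaleR_diff_right)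
    then have "F_map p j x = (1/2) *\<^sub>R x + (1/2) *\<^sub>R p j"
      by simp
    then have "norm (F_map p j x) \<le> norm x / 2 + norm (p j) / 2"
      using norm_triangle_ineq[of "(1/2) *\<^sub>R x" "(1/2) *\<^sub>R p j"] by simp
    then show ?thesis
      using R[OF that(1)] that(2) by simp
  qed
  have dec1: "C (Suc n) \<subseteq> C n" for n
  proof (induction n)
    case 0
    show ?case
      using into by (auto simp only: CS C0)
  next
    case (Suc n)
    have "C (Suc (Suc n)) = (\<Union>j<N. F_map p j ` C (Suc n))"
      by (rule CS)
    also have "\<dots> \<subseteq> (\<Union>j<N. F_map p j ` C n)"
      using Suc by blast
    also have "\<dots> = C (Suc n)"
      by (rule CS[symmetric])
    finally show ?case .
  qed
  have dec: "C n \<subseteq> C m" if "m \<le> n" for m n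
    using lift_Suc_antimono_le[of C, OF dec1 that] .
  have comp: "compact (C n)" for n
    by (induction n) (auto simp: C0 CS intro!: compact_UN compact_continuous_image continuous_on_F_map)
  have ne: "C n \<noteq> {}" for n
    using assms R0 by (induction n) (auto simp: C0 CS)
  define K where "K = (\<Inter>n. C n)"
  have "K \<noteq> {}"
    unfolding K_def using compact_nest[of C] comp ne dec by auto
  moreover have "compact K"
    unfolding K_def using comp by (intro compact_Inter) auto
  moreover have "(\<Union>j<N. F_map p j ` K) \<subseteq> K"
  proof -
    have "F_map p j x \<in> C n" if "j < N" "x \<in> K" for j x n
      using that dec1[of n] CS[of n] by (auto simp: K_def)
    then show ?thesis
      by (auto simp: K_def)
  qed
  moreover have "K \<subseteq> (\<Union>j<N. F_map p j ` K)"
  proof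
    fix x assume x: "x \<in> K"
    define g where "g j = 2 *\<^sub>R x - p j" for j
    have g: "F_map p j y = x \<longleftrightarrow> y = g j" for j y
    proof -
      have "2 *\<^sub>R F_map p j y = y + p j"
        by (simp add: F_map_def scaleR_add_right scaleR_2)
      moreover have "F_map p j y = x \<longleftrightarrow> 2 *\<^sub>R F_map p j y = 2 *\<^sub>R x"
        by simp
      ultimately show ?thesis
        by (auto simp: g_def eq_diff_eq)
    qed
    have "\<exists>j<N. \<forall>n. g j \<in> C n"
    proof (rule ccontr)
      assume "\<not> ?thesis"
      then obtain m where m: "\<And>j. j < N \<Longrightarrow> g j \<notin> C (m j)"
        by metis
      define M where "M = (\<Sum>j<N. m j)"
      have "x \<in> C (Suc M)"
        using x by (auto simp: K_def)
      then obtain j y where jy: "j < N" "y \<in> C M" "x = F_map p j y"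
        by (auto simp: CS)
      have "m j \<le> M"
        unfolding M_def by (rule member_le_sum) (use jy in auto)
      then have "C M \<subseteq> C (m j)"
        by (rule dec)
      moreover have "y = g j"
        by (rule iffD1[OF g jy(3)[symmetric]])
      ultimately show False
        using m[OF jy(1)] jy(2) by blast
    qed
    then obtain j where j: "j < N" "g j \<in> K"
      by (auto simp: K_def)
    have "F_map p j (g j) = x"
      by (rule iffD2[OF g refl])
    then show "x \<in> (\<Union>j<N. F_map p j ` K)"
      using j by blast
  qed
  ultimately show ?thesis
    unfolding is_gasket_def by blast
qed

lemma is_gasket_SG:
  assumes "N > 0"
  shows "is_gasket N p (SG N p)"
  unfolding SG_def
proof (rule theI')
  obtain K where K: "is_gasket N p K"
    using is_gasket_exists[OF assms] by blast
  then show "\<exists>!K. is_gasket N p K"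
    by (metis is_gasket_subset subset_antisym)
qed

definition V0 :: "nat \<Rightarrow> (nat \<Rightarrow> 'a::euclidean_space) \<Rightarrow> 'a set" where
  "V0 N p = p ` {..<N}"

definition words :: "nat \<Rightarrow> nat \<Rightarrow> nat list set" where
  "words N m = {w. length w = m \<and> set w \<subseteq> {..<N}}"

definition V_level :: "nat \<Rightarrow> (nat \<Rightarrow> 'a::euclidean_space) \<Rightarrow> nat \<Rightarrow> 'a set" where
  "V_level N p m = (\<Union>w\<in>words N m. F_word p w ` V0 N p)"

definition adj :: "nat \<Rightarrow> (nat \<Rightarrow> 'a::euclidean_space) \<Rightarrow> nat \<Rightarrow> 'a \<Rightarrow> 'a \<Rightarrow> bool" where
  "adj N p m x y \<longleftrightarrow> x \<in> V_level N p m \<and> y \<in> V_level N p m \<and> x \<noteq> y \<and>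
     (\<exists>w\<in>words N m. x \<in> F_word p w ` V0 N p \<and> y \<in> F_word p w ` V0 N p)"

text \<open>
  Each (unordered) edge occurs as two ordered pairs, whence the factor \<open>1/2\<close>.
\<close>

definition energy_level ::
  "nat \<Rightarrow> (nat \<Rightarrow> 'a::euclidean_space) \<Rightarrow> nat \<Rightarrow> ('a \<Rightarrow> real) \<Rightarrow> ('a \<Rightarrow> real) \<Rightarrow> real" where
  "energy_level N p m u v = ((real N + 2) / real N) ^ m *
     (1/2 * (\<Sum>(x, y) \<in> {(x, y). adj N p m x y}. (u x - u y) * (v x - v y)))"

definition energy ::
  "nat \<Rightarrow> (nat \<Rightarrow> 'a::euclidean_space) \<Rightarrow> ('a \<Rightarrow> real) \<Rightarrow> ('a \<Rightarrow> real) \<Rightarrow> real" where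
  "energy N p u v = lim (\<lambda>m. energy_level N p m u v)"

text \<open>
  As \<open>energy_level N p m u u\<close> is non-decreasing in \<open>m\<close>, its limit is finite iff the sequence
  converges in the reals.
\<close>

definition dom_energy :: "nat \<Rightarrow> (nat \<Rightarrow> 'a::euclidean_space) \<Rightarrow> ('a \<Rightarrow> real) set" where
  "dom_energy N p =
     {u. continuous_on (SG N p) u \<and> convergent (\<lambda>m. energy_level N p m u u)}"

definition dom0_energy :: "nat \<Rightarrow> (nat \<Rightarrow> 'a::euclidean_space) \<Rightarrow> ('a \<Rightarrow> real) set" where
  "dom0_energy N p = {u \<in> dom_energy N p. \<forall>x\<in>V0 N p. u x = 0}"

definition standard_bernoulli ::
  "nat \<Rightarrow> (nat \<Rightarrow> 'a::euclidean_space) \<Rightarrow> 'a measure \<Rightarrow> bool" where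
  "standard_bernoulli N p \<mu> \<longleftrightarrow>
     prob_space \<mu> \<and> sets \<mu> = sets (restrict_space borel (SG N p)) \<and>
     (\<forall>A\<in>sets \<mu>. measure \<mu> A =
        1 / real N * (\<Sum>i<N. measure \<mu> (F_map p i -` A \<inter> SG N p)))"

definition word_measure :: "nat \<Rightarrow> (nat \<Rightarrow> nat) measure" where
  "word_measure N = (\<Pi>\<^sub>M n\<in>UNIV. uniform_count_measure {..<N})"

definition has_laplacian ::
  "nat \<Rightarrow> (nat \<Rightarrow> 'a::euclidean_space) \<Rightarrow> 'a measure \<Rightarrow> ('a \<Rightarrow> real) \<Rightarrow> ('a \<Rightarrow> real) \<Rightarrow> bool" where
  "has_laplacian N p \<mu> u f \<longleftrightarrow>
     u \<in> dom_energy N p \<and> continuous_on (SG N p) f \<and>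
     (\<forall>v\<in>dom0_energy N p. energy N p u v = - (LINT x|\<mu>. f x * v x))"

definition dom_laplacian ::
  "nat \<Rightarrow> (nat \<Rightarrow> 'a::euclidean_space) \<Rightarrow> 'a measure \<Rightarrow> ('a \<Rightarrow> real) set" where
  "dom_laplacian N p \<mu> = {u. \<exists>f. has_laplacian N p \<mu> u f}"

definition harmonic :: "nat \<Rightarrow> (nat \<Rightarrow> 'a::euclidean_space) \<Rightarrow> ('a \<Rightarrow> real) set" where
  "harmonic N p = {h \<in> dom_energy N p. \<forall>g. (\<forall>x\<in>V0 N p. g x = h x) \<longrightarrow>
     (\<forall>n\<ge>1. energy_level N p n h h \<le> energy_level N p n g g)}"

text \<open>
  The quotient of the harmonic functions by the constants. The values off the gasket are
  factored out as well, so the classes are those of harmonic functions on the gasket.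
\<close>

definition const_rel ::
  "nat \<Rightarrow> (nat \<Rightarrow> 'a::euclidean_space) \<Rightarrow> (('a \<Rightarrow> real) \<times> ('a \<Rightarrow> real)) set" where
  "const_rel N p = {(g, h). g \<in> harmonic N p \<and> h \<in> harmonic N p \<and>
     (\<exists>c. \<forall>x\<in>SG N p. g x - h x = c)}"

definition Htilde :: "nat \<Rightarrow> (nat \<Rightarrow> 'a::euclidean_space) \<Rightarrow> ('a \<Rightarrow> real) set set" where
  "Htilde N p = harmonic N p // const_rel N p"

definition P_tilde :: "nat \<Rightarrow> (nat \<Rightarrow> 'a::euclidean_space) \<Rightarrow> ('a \<Rightarrow> real) \<Rightarrow> ('a \<Rightarrow> real) set" where
  "P_tilde N p h = const_rel N p `` {h}"

text \<open>
  Operations on classes are unions over representatives, as in the theory of equivalence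
  relations of the library: all representatives give the same class. The inner product
  likewise does not depend on the chosen representatives.
\<close>

definition diff_tilde ::
  "nat \<Rightarrow> (nat \<Rightarrow> 'a::euclidean_space) \<Rightarrow>
   ('a \<Rightarrow> real) set \<Rightarrow> ('a \<Rightarrow> real) set \<Rightarrow> ('a \<Rightarrow> real) set" where
  "diff_tilde N p X Y = (\<Union>g\<in>X. \<Union>h\<in>Y. P_tilde N p (\<lambda>x. g x - h x))"

definition inner_tilde ::
  "nat \<Rightarrow> (nat \<Rightarrow> 'a::euclidean_space) \<Rightarrow> ('a \<Rightarrow> real) set \<Rightarrow> ('a \<Rightarrow> real) set \<Rightarrow> real" where
  "inner_tilde N p X Y = energy N p (SOME g. g \<in> X) (SOME h. h \<in> Y)"

definition dist_tilde ::
  "nat \<Rightarrow> (nat \<Rightarrow> 'a::euclidean_space) \<Rightarrow> ('a \<Rightarrow> real) set \<Rightarrow> ('a \<Rightarrow> real) set \<Rightarrow> real" where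
  "dist_tilde N p X Y = sqrt (inner_tilde N p (diff_tilde N p X Y) (diff_tilde N p X Y))"

definition A_tilde ::
  "nat \<Rightarrow> (nat \<Rightarrow> 'a::euclidean_space) \<Rightarrow> nat \<Rightarrow> ('a \<Rightarrow> real) set \<Rightarrow> ('a \<Rightarrow> real) set" where
  "A_tilde N p i X = (\<Union>h\<in>X. P_tilde N p (h \<circ> F_map p i))"

fun A_tilde_word ::
  "nat \<Rightarrow> (nat \<Rightarrow> 'a::euclidean_space) \<Rightarrow> nat list \<Rightarrow> ('a \<Rightarrow> real) set \<Rightarrow> ('a \<Rightarrow> real) set" where
  "A_tilde_word N p [] = id"
| "A_tilde_word N p (i # w) = A_tilde_word N p w \<circ> A_tilde N p i"

text \<open>
  Harmonic functions are determined by their boundary values on the gasket only, so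
  \<open>H_ext N p g\<close> involves an arbitrary choice of values off the gasket; \<open>H_tilde N p g\<close> does not.
\<close>

definition H_ext :: "nat \<Rightarrow> (nat \<Rightarrow> 'a::euclidean_space) \<Rightarrow> ('a \<Rightarrow> real) \<Rightarrow> ('a \<Rightarrow> real)" where
  "H_ext N p g = (SOME h. h \<in> harmonic N p \<and> (\<forall>x\<in>V0 N p. h x = g x))"

definition H_tilde :: "nat \<Rightarrow> (nat \<Rightarrow> 'a::euclidean_space) \<Rightarrow> ('a \<Rightarrow> real) \<Rightarrow> ('a \<Rightarrow> real) set" where
  "H_tilde N p g = P_tilde N p (H_ext N p g)"

text \<open>
  Infinite words are indexed from \<open>0\<close>: the first \<open>n\<close> letters of \<open>\<omega>\<close> are
  \<open>\<omega> 0, \<dots>, \<omega> (n - 1)\<close>.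
\<close>

definition grad_n ::
  "nat \<Rightarrow> (nat \<Rightarrow> 'a::euclidean_space) \<Rightarrow> nat \<Rightarrow> ('a \<Rightarrow> real) \<Rightarrow> (nat \<Rightarrow> nat) \<Rightarrow> ('a \<Rightarrow> real) set" where
  "grad_n N p n f \<omega> =
     inv_into (Htilde N p) (A_tilde_word N p (map \<omega> [0..<n]))
       (H_tilde N p (f \<circ> F_word p (map \<omega> [0..<n])))"

definition has_gradient ::
  "nat \<Rightarrow> (nat \<Rightarrow> 'a::euclidean_space) \<Rightarrow> ('a \<Rightarrow> real) \<Rightarrow> (nat \<Rightarrow> nat) \<Rightarrow> ('a \<Rightarrow> real) set \<Rightarrow> bool" where
  "has_gradient N p f \<omega> L \<longleftrightarrow>
     L \<in> Htilde N p \<and> (\<lambda>n. dist_tilde N p (grad_n N p n f \<omega>) L) \<longlonglongrightarrow> 0"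

definition gradient_defined ::
  "nat \<Rightarrow> (nat \<Rightarrow> 'a::euclidean_space) \<Rightarrow> ('a \<Rightarrow> real) \<Rightarrow> (nat \<Rightarrow> nat) \<Rightarrow> bool" where
  "gradient_defined N p f \<omega> \<longleftrightarrow> (\<exists>L. has_gradient N p f \<omega> L)"

end

theory Submission
  imports Defs
begin

text \<open>
  Let \<open>w\<close> be the first \<open>n\<close> letters of \<open>\<omega>\<close> and \<open>i\<close> the next one. Modulo constants, a harmonic function
  is its vector of boundary values, and the inverse of \<open>A_tilde_word\<close> is a product of explicit
  matrices. The step from the approximation of the gradient on level \<open>n\<close> to the one on level \<open>n + 1\<close>
  changes the vector by the inverse along \<open>w @ [i]\<close> applied to a defect: the difference between the
  values of \<open>u\<close> at the corners of the cell \<open>w @ [i]\<close> and the values there of the harmonic extension of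
  \<open>u\<close> from the corners of the cell \<open>w\<close>. The gradient exists when these changes are summable.

  The defect is at most a constant times \<open>1 / (N + 2) ^ n\<close> (\<open>harmonic_defect_le\<close>). This is the scaling
  of the Laplacian: test functions supported in the cell \<open>w\<close> see an energy renormalised by
  \<open>((N + 2) / N) ^ (n + 1)\<close> and a measure of at most \<open>1 / N ^ n\<close>. A discrete maximum principle turns the
  bound for the Laplacian into a bound for the values.

  The inverse along a word of length \<open>n\<close> may have norm \<open>(N + 2) ^ n\<close>, as it does for a constant word,
  which just fails to give convergence. But in the energy norm the inverse for the letter \<open>i\<close>, divided
  by \<open>N + 2\<close>, is the identity on the vectors whose \<open>i\<close>-th entry equals the mean, and multiplication by
  \<open>1 / N\<close> on the orthogonal complement. No non-constant vector is of the first kind for all \<open>i\<close>.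
  Averaged over the letters, the square norm of every vector is therefore multiplied by
  \<open>(N\<^sup>2 - N - 1) / N\<^sup>2 < 1\<close> (\<open>sum_form0_cell_ext_inv\<close>). The letters of a random word are independent, so
  the expected square of the Hilbert-Schmidt norm of the product, divided by \<open>(N + 2) ^ (2 * n)\<close>,
  decays geometrically (\<open>sum_growth\<close>). A series with finite expectation converges almost surely, and
  the convergence of the gradient follows.

  The link between the definitions by energies and the matrices is \<open>harmonic_iff\<close>: the harmonic
  functions are the limits of piecewise affine interpolations of values produced by the harmonic
  extension matrices.
\<close>

section \<open>Linear algebra of the harmonic extension\<close>

text \<open>
  The energy of level \<open>0\<close> as a bilinear form in vectors of boundary values, of which the entries
  below \<open>N\<close> matter. It is an inner product modulo constant vectors.
\<close>

definition form0 :: "nat \<Rightarrow> (nat \<Rightarrow> real) \<Rightarrow> (nat \<Rightarrow> real) \<Rightarrow> real" where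
  "form0 N b c = (1/2) * (\<Sum>i<N. \<Sum>j<N. (b i - b j) * (c i - c j))"

text \<open>
  The harmonic extension matrix of the cell \<open>i\<close>: the harmonic function with boundary values \<open>b\<close>
  takes at the midpoint of \<open>p i\<close> and \<open>p j\<close> the average of \<open>b\<close> in which \<open>i\<close> and \<open>j\<close> have double weight.
\<close>

definition cell_ext :: "nat \<Rightarrow> nat \<Rightarrow> (nat \<Rightarrow> real) \<Rightarrow> nat \<Rightarrow> real" where
  "cell_ext N i b = (\<lambda>j. if j = i then b i else (b i + b j + (\<Sum>k<N. b k)) / (real N + 2))"

definition cell_ext_inv :: "nat \<Rightarrow> nat \<Rightarrow> (nat \<Rightarrow> real) \<Rightarrow> nat \<Rightarrow> real" where
  "cell_ext_inv N i c =
     (\<lambda>j. if j = i then c i else c i + (real N + 2) * (c j - (\<Sum>k<N. c k) / real N))"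

lemma form0_eq: "form0 N b c = real N * (\<Sum>i<N. b i * c i) - (\<Sum>i<N. b i) * (\<Sum>i<N. c i)"
proof -
  have "(\<Sum>i<N. \<Sum>j<N. (b i - b j) * (c i - c j)) =
    (\<Sum>i<N. \<Sum>j<N. b i * c i) + (\<Sum>i<N. \<Sum>j<N. b j * c j)
      - (\<Sum>i<N. \<Sum>j<N. b i * c j) - (\<Sum>i<N. \<Sum>j<N. b j * c i)"
    by (simp add: algebra_simps sum.distrib sum_subtractf)
  moreover have "(\<Sum>i<N. \<Sum>j<N. b j * c i) = (\<Sum>i<N. \<Sum>j<N. b i * c j)"
    by (rule sum.swap)
  moreover have "(\<Sum>i<N. \<Sum>j<N. b i * c j) = (\<Sum>i<N. b i) * (\<Sum>i<N. c i)"
    by (simp add: sum_product)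
  ultimately show ?thesis
    by (simp add: form0_def flip: sum_distrib_left)
qed

lemma form0_eq_sum: "form0 N b c = (\<Sum>j<N. (real N * b j - (\<Sum>k<N. b k)) * c j)"
  by (simp add: form0_eq left_diff_distrib sum_subtractf sum_distrib_left mult.assoc)

lemma form0_commute: "form0 N b c = form0 N c b"
  by (simp add: form0_def mult.commute)

lemma form0_add_left: "form0 N (\<lambda>j. b j + b' j) c = form0 N b c + form0 N b' c"
  by (simp add: form0_eq algebra_simps sum.distrib)

lemma form0_diff_left: "form0 N (\<lambda>j. x j - y j) c = form0 N x c - form0 N y c"
  using form0_add_left[of N "\<lambda>j. x j - y j" y c] by simp

lemma form0_cong:
  assumes "\<And>j. j < N \<Longrightarrow> b j = b' j" "\<And>j. j < N \<Longrightarrow> c j = c' j"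
  shows "form0 N b c = form0 N b' c'"
  unfolding form0_def using assms by (intro arg_cong2[where f = "(*)"] sum.cong) auto

lemma form0_nonneg: "form0 N b b \<ge> 0"
  by (auto simp: form0_def intro!: sum_nonneg)

lemma diff_sq_le_form0:
  assumes "j < N" "k < N"
  shows "(b j - b k)\<^sup>2 \<le> form0 N b b"
proof (cases "j = k")
  case True
  then show ?thesis by (simp add: form0_nonneg)
next
  case False
  let ?g = "\<lambda>i l. (b i - b l) * (b i - b l)"
  have row: "?g i l \<le> (\<Sum>l<N. ?g i l)" if "l < N" for i l
    using that by (intro member_le_sum) auto
  have "?g j k + ?g k j \<le> (\<Sum>l<N. ?g j l) + (\<Sum>l<N. ?g k l)"
    using row[OF assms(2), of j] row[OF assms(1), of k] by linarith
  also have "\<dots> = (\<Sum>i\<in>{j, k}. \<Sum>l<N. ?g i l)"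
    using False by simp
  also have "\<dots> \<le> (\<Sum>i<N. \<Sum>l<N. ?g i l)"
    using assms by (intro sum_mono2) (auto intro!: sum_nonneg)
  finally show ?thesis
    by (simp add: form0_def power2_eq_square algebra_simps)
qed

lemma abs_diff_le_form0:
  assumes "j < N" "k < N"
  shows "\<bar>b j - b k\<bar> \<le> sqrt (form0 N b b)"
  using diff_sq_le_form0[OF assms] by (metis real_sqrt_abs real_sqrt_le_mono)

lemma form0_eq_0_iff: "form0 N b b = 0 \<longleftrightarrow> (\<forall>j<N. \<forall>k<N. b j = b k)"
proof
  assume 0: "form0 N b b = 0"
  show "\<forall>j<N. \<forall>k<N. b j = b k"
  proof (intro allI impI)
    fix j k assume "j < N" "k < N"
    then show "b j = b k"
      using abs_diff_le_form0[of j N k b] 0 by simp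
  qed
next
  assume const: "\<forall>j<N. \<forall>k<N. b j = b k"
  have b0: "b j = b 0" if "j < N" for j
  proof -
    have "0 < N" using that by simp
    then show ?thesis using const that by blast
  qed
  have "form0 N b b = form0 N (\<lambda>_. b 0) (\<lambda>_. b 0)"
    by (rule form0_cong; rule b0)
  then show "form0 N b b = 0"
    by (simp add: form0_def)
qed

text \<open>
  The Cauchy-Schwarz inequality for each pair of coordinates. It bounds the norm of a matrix by its
  Hilbert-Schmidt norm, \<open>v k\<close> being the columns.
\<close>

lemma form0_sum_le:
  assumes "finite S"
  shows "form0 N (\<lambda>j. \<Sum>k\<in>S. d k * v k j) (\<lambda>j. \<Sum>k\<in>S. d k * v k j)
    \<le> (\<Sum>k\<in>S. (d k)\<^sup>2) * (\<Sum>k\<in>S. form0 N (v k) (v k))"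
proof -
  have "((\<Sum>k\<in>S. d k * v k i) - (\<Sum>k\<in>S. d k * v k j))\<^sup>2
      \<le> (\<Sum>k\<in>S. (d k)\<^sup>2) * (\<Sum>k\<in>S. (v k i - v k j)\<^sup>2)" for i j
    using Cauchy_Schwarz_ineq_sum[of d "\<lambda>k. v k i - v k j" S]
    by (simp add: right_diff_distrib sum_subtractf)
  then have "form0 N (\<lambda>j. \<Sum>k\<in>S. d k * v k j) (\<lambda>j. \<Sum>k\<in>S. d k * v k j)
    \<le> (1/2) * (\<Sum>i<N. \<Sum>j<N. (\<Sum>k\<in>S. (d k)\<^sup>2) * (\<Sum>k\<in>S. (v k i - v k j)\<^sup>2))"
    unfolding form0_def power2_eq_square[symmetric] by (intro mult_left_mono sum_mono) auto
  also have "\<dots> = (\<Sum>k\<in>S. (d k)\<^sup>2) * ((1/2) * (\<Sum>i<N. \<Sum>j<N. \<Sum>k\<in>S. (v k i - v k j)\<^sup>2))"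
    by (simp add: sum_distrib_left mult_ac)
  also have "(\<Sum>i<N. \<Sum>j<N. \<Sum>k\<in>S. (v k i - v k j)\<^sup>2) = (\<Sum>k\<in>S. \<Sum>i<N. \<Sum>j<N. (v k i - v k j)\<^sup>2)"
    using sum.swap[of "\<lambda>i k. \<Sum>j<N. (v k i - v k j)\<^sup>2" S "{..<N}"]
      sum.swap[of "\<lambda>j k. (v k i - v k j)\<^sup>2" S "{..<N}" for i] by simp
  also have "(1/2) * \<dots> = (\<Sum>k\<in>S. form0 N (v k) (v k))"
    by (simp add: form0_def sum_distrib_left power2_eq_square)
  finally show ?thesis .
qed

lemma sum_cell_ext:
  assumes "i < N"
  shows "(\<Sum>j<N. cell_ext N i b j) = real N * (2 * b i + (\<Sum>k<N. b k)) / (real N + 2)"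
proof -
  define s where "s = (\<Sum>k<N. b k)"
  have n2: "real N + 2 \<noteq> 0" by linarith
  have "cell_ext N i b j = (b i + b j + s) / (real N + 2)
      + (if j = i then (real N * b i - s) / (real N + 2) else 0)" for j
    using n2 by (auto simp: cell_ext_def s_def[symmetric] simp flip: add_divide_distrib)
       (simp add: field_simps)
  then have "(\<Sum>j<N. cell_ext N i b j) =
      (\<Sum>j<N. (b i + b j + s) / (real N + 2)) + (real N * b i - s) / (real N + 2)"
    using assms by (simp add: sum.distrib)
  also have "(\<Sum>j<N. (b i + b j + s) / (real N + 2)) = (real N * b i + s + real N * s) / (real N + 2)"
    by (simp add: sum.distrib s_def flip: sum_divide_distrib)
  finally have "(\<Sum>j<N. cell_ext N i b j) =
      (real N * b i + s + real N * s) / (real N + 2) + (real N * b i - s) / (real N + 2)" .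
  also have "\<dots> = real N * (2 * b i + s) / (real N + 2)"
    by (simp add: algebra_simps flip: add_divide_distrib)
  finally show ?thesis
    by (simp add: s_def)
qed

lemma form0_cell_ext:
  assumes "i < N"
  shows "(real N + 2) / real N * form0 N (cell_ext N i b) c =
    (real N * b i - (\<Sum>k<N. b k)) * c i + (\<Sum>j<N. (b j - b i) * c j)"
proof -
  have N: "real N > 0" using assms by simp
  have "(real N + 2) / real N * (real N * cell_ext N i b j - (\<Sum>k<N. cell_ext N i b k)) =
     (if j = i then real N * b i - (\<Sum>k<N. b k) else 0) + (b j - b i)" for j
  proof -
    define M where "M = real N"
    define s where "s = (\<Sum>k<N. b k)"
    have M: "M > 0" "M + 2 > 0" using N by (auto simp: M_def)
    have "(M + 2) / M * (M * ((b i + b j + s) / (M + 2)) - M * (2 * b i + s) / (M + 2)) = b j - b i"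
      "(M + 2) / M * (M * b i - M * (2 * b i + s) / (M + 2)) = M * b i - s"
      using M by (simp_all add: divide_simps) (simp_all add: algebra_simps)
    then show ?thesis
      unfolding sum_cell_ext[OF assms] by (simp add: cell_ext_def M_def s_def)
  qed
  then have "(real N + 2) / real N * ((real N * cell_ext N i b j - (\<Sum>k<N. cell_ext N i b k)) * c j) =
     (if j = i then (real N * b i - (\<Sum>k<N. b k)) * c i else 0) + (b j - b i) * c j" for j
    by (auto simp: distrib_right simp flip: mult.assoc)
  then show ?thesis
    unfolding form0_eq_sum sum_distrib_left using assms by (simp add: sum.distrib)
qed

text \<open>
  A symmetric \<open>c\<close> is a function on the vertices of level one. The extended vector has Laplacian zero
  at the midpoints: in the sum, the midpoints contribute with the antisymmetric weights
  \<open>b j - b i\<close>, which cancel against the symmetry of \<open>c\<close>, and only the corners survive.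
\<close>

lemma cell_ext_harmonic:
  assumes "N > 0" and sym: "\<And>i j. i < N \<Longrightarrow> j < N \<Longrightarrow> c i j = c j i"
  shows "(real N + 2) / real N * (\<Sum>i<N. form0 N (cell_ext N i b) (c i)) = form0 N b (\<lambda>i. c i i)"
proof -
  have "(\<Sum>i<N. \<Sum>j<N. (b j - b i) * c i j) = (\<Sum>i<N. \<Sum>j<N. b j * c i j) - (\<Sum>i<N. \<Sum>j<N. b i * c i j)"
    by (simp add: left_diff_distrib sum_subtractf)
  also have "(\<Sum>i<N. \<Sum>j<N. b i * c i j) = (\<Sum>j<N. \<Sum>i<N. b i * c i j)"
    by (rule sum.swap)
  also have "\<dots> = (\<Sum>i<N. \<Sum>j<N. b j * c i j)"
    using sym by (intro sum.cong refl) auto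
  finally show ?thesis
    unfolding form0_eq_sum[of N b] sum_distrib_left by (simp add: form0_cell_ext sum.distrib del: times_divide_eq_left)
qed

lemma cell_ext_sym: "cell_ext N i b j = cell_ext N j b i"
  by (simp add: cell_ext_def add.commute add.left_commute)

lemma cell_ext_diag [simp]: "cell_ext N i b i = b i"
  by (simp add: cell_ext_def)

lemma form0_cell_ext_le:
  assumes "i < N"
  shows "form0 N (cell_ext N i b) (cell_ext N i b) \<le> real N / (real N + 2) * form0 N b b"
proof -
  define S where "S = (\<Sum>i<N. form0 N (cell_ext N i b) (cell_ext N i b))"
  have "form0 N (cell_ext N i b) (cell_ext N i b) \<le> S"
    unfolding S_def using assms
    by (intro member_le_sum[where f = "\<lambda>i. form0 N (cell_ext N i b) (cell_ext N i b)"])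
      (auto simp: form0_nonneg)
  then have "(real N + 2) / real N * form0 N (cell_ext N i b) (cell_ext N i b) \<le> (real N + 2) / real N * S"
    by (intro mult_left_mono) auto
  also have "(real N + 2) / real N * S = form0 N b b"
    unfolding S_def using assms by (subst cell_ext_harmonic) (auto intro: cell_ext_sym)
  finally have "(real N + 2) / real N * form0 N (cell_ext N i b) (cell_ext N i b) \<le> form0 N b b" .
  moreover have "real N > 0" "real N + 2 > 0"
    using assms by auto
  ultimately show ?thesis
    by (simp add: divide_simps) (simp add: algebra_simps)
qed

lemma cell_ext_linear:
  "cell_ext N i (\<lambda>j. s * b j + t * c j) = (\<lambda>j. s * cell_ext N i b j + t * cell_ext N i c j)"
proof -
  have "(\<Sum>j<N. s * b j + t * c j) = s * (\<Sum>j<N. b j) + t * (\<Sum>j<N. c j)"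
    by (simp add: sum.distrib sum_distrib_left)
  then show ?thesis
    by (simp add: cell_ext_def fun_eq_iff add_divide_distrib distrib_left)
qed

lemma cell_ext_const:
  "cell_ext N i (\<lambda>_. t) = (\<lambda>_. t)"
proof -
  have "(t + t + real N * t) / (real N + 2) = t * (real N + 2) / (real N + 2)"
    by (simp add: algebra_simps)
  also have "\<dots> = t"
    by (rule nonzero_mult_div_cancel_right) linarith
  finally show ?thesis
    by (auto simp: cell_ext_def)
qed

lemma cell_ext_cong:
  assumes "i < N" "\<And>j. j < N \<Longrightarrow> b j = b' j" "j < N"
  shows "cell_ext N i b j = cell_ext N i b' j"
  using assms by (simp add: cell_ext_def)

lemma cell_ext_inv_linear:
  "cell_ext_inv N i (\<lambda>j. s * b j + t * c j) = (\<lambda>j. s * cell_ext_inv N i b j + t * cell_ext_inv N i c j)"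
proof -
  have "(\<Sum>j<N. s * b j + t * c j) = s * (\<Sum>j<N. b j) + t * (\<Sum>j<N. c j)"
    by (simp add: sum.distrib sum_distrib_left)
  then show ?thesis
    by (simp add: cell_ext_inv_def fun_eq_iff add_divide_distrib) (simp add: algebra_simps)
qed

lemma sum_cell_ext_inv:
  assumes "i < N"
  shows "(\<Sum>j<N. cell_ext_inv N i c j) = real N * c i - (real N + 2) * (c i - (\<Sum>k<N. c k) / real N)"
proof -
  define a where "a = (\<Sum>k<N. c k) / real N"
  have "cell_ext_inv N i c j = c i + (real N + 2) * (c j - a) - (if j = i then (real N + 2) * (c i - a) else 0)" for j
    by (simp add: cell_ext_inv_def a_def)
  then have "(\<Sum>j<N. cell_ext_inv N i c j) =
      real N * c i + (real N + 2) * ((\<Sum>j<N. c j) - real N * a) - (real N + 2) * (c i - a)"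
    using assms by (simp add: sum.distrib sum_subtractf flip: sum_distrib_left)
  moreover have "(\<Sum>j<N. c j) - real N * a = 0"
    using assms by (simp add: a_def)
  ultimately show ?thesis by (simp add: a_def)
qed

lemma cell_ext_cell_ext_inv:
  assumes "i < N"
  shows "cell_ext N i (cell_ext_inv N i c) = c"
proof
  fix j
  define a where "a = (\<Sum>k<N. c k) / real N"
  show "cell_ext N i (cell_ext_inv N i c) j = c j"
  proof (cases "j = i")
    case False
    have "c i + (c i + (real N + 2) * (c j - a)) + (real N * c i - (real N + 2) * (c i - a)) = c j * (real N + 2)"
      by (simp add: algebra_simps)
    moreover have "real N + 2 > 0" by simp
    ultimately have "(c i + (c i + (real N + 2) * (c j - a))
        + (real N * c i - (real N + 2) * (c i - a))) / (real N + 2) = c j"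
      by simp
    then show ?thesis
      using False unfolding cell_ext_def sum_cell_ext_inv[OF assms]
      by (simp add: cell_ext_inv_def a_def)
  qed (simp add: cell_ext_inv_def)
qed

lemma cell_ext_inv_cell_ext:
  assumes "i < N"
  shows "cell_ext_inv N i (cell_ext N i b) = b"
proof
  fix j
  show "cell_ext_inv N i (cell_ext N i b) j = b j"
  proof (cases "j = i")
    case False
    define M where "M = real N"
    define s where "s = (\<Sum>k<N. b k)"
    have M: "M > 0" "M + 2 > 0" using assms by (auto simp: M_def)
    have "b i + (M + 2) * ((b i + b j + s) / (M + 2) - M * (2 * b i + s) / (M + 2) / M) = b j"
      using M by (simp add: divide_simps)
    moreover have "cell_ext_inv N i (cell_ext N i b) j =
        b i + (M + 2) * ((b i + b j + s) / (M + 2) - M * (2 * b i + s) / (M + 2) / M)"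
      using False unfolding cell_ext_inv_def sum_cell_ext[OF assms]
      by (simp add: cell_ext_def M_def s_def)
    ultimately show ?thesis by simp
  qed (simp add: cell_ext_inv_def)
qed

text \<open>
  Up to the factor \<open>N + 2\<close> and a constant vector, the inverse extension subtracts the mean and then
  deletes the \<open>i\<close>-th coordinate. So it expands a vector at most by \<open>N + 2\<close>, and by less unless the
  \<open>i\<close>-th coordinate equals the mean.
\<close>

lemma form0_cell_ext_inv:
  assumes "i < N"
  shows "form0 N (cell_ext_inv N i c) (cell_ext_inv N i c) =
    (real N + 2)\<^sup>2 * (form0 N c c - (real N + 1) * (c i - (\<Sum>k<N. c k) / real N)\<^sup>2)"
proof -
  define a where "a = (\<Sum>k<N. c k) / real N"
  define y where "y j = c j - a" for j
  have N: "real N > 0" using assms by simp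
  have y0: "(\<Sum>j<N. y j) = 0"
    using N by (simp add: y_def sum_subtractf a_def)
  define z where "z j = (if j = i then 0 else y j)" for j
  have z: "z j = y j - (if j = i then y i else 0)" for j
    by (simp add: z_def)
  have z1: "(\<Sum>j<N. z j) = - y i"
    unfolding z using assms y0 by (simp add: sum_subtractf)
  have "z j * z j = y j * y j - (if j = i then y i * y i else 0)" for j
    by (simp add: z_def)
  then have z2: "(\<Sum>j<N. z j * z j) = (\<Sum>j<N. y j * y j) - y i * y i"
    using assms by (simp add: sum_subtractf)
  have "form0 N (cell_ext_inv N i c) (cell_ext_inv N i c) = (real N + 2)\<^sup>2 * form0 N z z"
  proof -
    have "cell_ext_inv N i c j - cell_ext_inv N i c k = (real N + 2) * (z j - z k)" for j k
      unfolding cell_ext_inv_def a_def[symmetric] by (auto simp: z_def y_def algebra_simps)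
    then show ?thesis
      by (simp add: form0_def sum_distrib_left power2_eq_square mult_ac)
  qed
  also have "form0 N z z = real N * (\<Sum>j<N. y j * y j) - (real N + 1) * (y i)\<^sup>2"
    unfolding form0_eq z1 z2 by (simp add: power2_eq_square algebra_simps)
  also have "real N * (\<Sum>j<N. y j * y j) = form0 N y y"
    unfolding form0_eq y0 by simp
  also have "form0 N y y = form0 N c c"
    by (simp add: form0_def y_def)
  finally show ?thesis
    by (simp add: y_def a_def)
qed

text \<open>
  No non-constant vector has all coordinates equal to its mean. Hence the average over the cells
  is strictly smaller than the maximal expansion \<open>(N + 2)\<^sup>2\<close>, by the factor
  \<open>(N\<^sup>2 - N - 1) / N\<^sup>2\<close>. This is the source of the almost sure convergence of the gradient.
\<close>

lemma sum_form0_cell_ext_inv: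
  assumes "N > 0"
  shows "(\<Sum>i<N. form0 N (cell_ext_inv N i c) (cell_ext_inv N i c)) =
    (real N + 2)\<^sup>2 * ((real N)\<^sup>2 - real N - 1) / real N * form0 N c c"
proof -
  define a where "a = (\<Sum>k<N. c k) / real N"
  have N: "real N > 0" using assms by simp
  have y0: "(\<Sum>j<N. c j - a) = 0"
    using N by (simp add: sum_subtractf a_def)
  have "form0 N c c = form0 N (\<lambda>j. c j - a) (\<lambda>j. c j - a)"
    by (simp add: form0_def)
  also have "\<dots> = real N * (\<Sum>i<N. (c i - a)\<^sup>2)"
    unfolding form0_eq y0 by (simp add: power2_eq_square)
  finally have eq: "(\<Sum>i<N. (c i - a)\<^sup>2) = form0 N c c / real N"
    using N by simp
  have "(\<Sum>i<N. form0 N (cell_ext_inv N i c) (cell_ext_inv N i c)) =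
      (\<Sum>i<N. (real N + 2)\<^sup>2 * (form0 N c c - (real N + 1) * (c i - a)\<^sup>2))"
    by (intro sum.cong refl) (simp add: form0_cell_ext_inv a_def)
  also have "\<dots> = (real N + 2)\<^sup>2 * (real N * form0 N c c - (real N + 1) * (\<Sum>i<N. (c i - a)\<^sup>2))"
    by (simp add: sum_subtractf flip: sum_distrib_left)
  also have "\<dots> = (real N + 2)\<^sup>2 * ((real N)\<^sup>2 - real N - 1) / real N * form0 N c c"
    unfolding eq using N by (simp add: field_simps power2_eq_square)
  finally show ?thesis .
qed

primrec word_ext_inv :: "nat \<Rightarrow> nat list \<Rightarrow> (nat \<Rightarrow> real) \<Rightarrow> nat \<Rightarrow> real" where
  "word_ext_inv N [] c = c"
| "word_ext_inv N (i # w) c = cell_ext_inv N i (word_ext_inv N w c)"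

lemma word_ext_inv_append:
  "word_ext_inv N (v @ w) c = word_ext_inv N v (word_ext_inv N w c)"
  by (induction v) auto

lemma word_ext_inv_linear:
  "word_ext_inv N w (\<lambda>j. s * b j + t * c j) =
    (\<lambda>j. s * word_ext_inv N w b j + t * word_ext_inv N w c j)"
  by (induction w) (auto simp: cell_ext_inv_linear)

lemma word_ext_inv_sum:
  "word_ext_inv N w (\<lambda>j. \<Sum>k<(n::nat). d k * v k j) = (\<lambda>j. \<Sum>k<n. d k * word_ext_inv N w (v k) j)"
proof (induction n)
  case 0
  show ?case
    using word_ext_inv_linear[of N w 0 "\<lambda>_. 0" 0 "\<lambda>_. 0"] by simp
next
  case (Suc n)
  show ?case
    using word_ext_inv_linear[of N w 1 "\<lambda>j. \<Sum>k<n. d k * v k j" "d n" "v n"] by (simp add: Suc)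
qed

text \<open>
  Where \<open>\<bar>D i j\<bar>\<close> attains its maximum \<open>M\<close>, each of the two row sums has at most \<open>N - 1\<close> non-zero
  terms, as the diagonal vanishes. They can compensate at most \<open>2 * (N - 1) * M\<close> of \<open>2 * N * M\<close>.
\<close>

lemma discrete_maximum_principle:
  fixes D :: "nat \<Rightarrow> nat \<Rightarrow> real"
  assumes "N > 0" and diag: "\<And>i. i < N \<Longrightarrow> D i i = 0"
    and eq: "\<And>i j. i < N \<Longrightarrow> j < N \<Longrightarrow> i \<noteq> j \<Longrightarrow>
      \<bar>2 * real N * D i j - (\<Sum>k<N. D i k) - (\<Sum>k<N. D j k)\<bar> \<le> \<epsilon>"
    and "\<epsilon> \<ge> 0" "i < N" "j < N"
  shows "\<bar>D i j\<bar> \<le> \<epsilon>"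
proof -
  define S where "S = (\<lambda>(i, j). \<bar>D i j\<bar>) ` ({..<N} \<times> {..<N})"
  have S: "finite S" "S \<noteq> {}"
    using assms(1) by (auto simp: S_def)
  define M where "M = Max S"
  have le: "\<bar>D i j\<bar> \<le> M" if "i < N" "j < N" for i j
    unfolding M_def by (rule Max_ge) (use S that in \<open>auto simp: S_def\<close>)
  obtain a b where ab: "a < N" "b < N" "M = \<bar>D a b\<bar>"
    using Max_in[OF S] unfolding M_def[symmetric] by (auto simp: S_def)
  have row: "\<bar>\<Sum>k<N. D i k\<bar> \<le> (real N - 1) * M" if "i < N" for i
  proof -
    have "\<bar>\<Sum>k<N. D i k\<bar> \<le> (\<Sum>k<N. \<bar>D i k\<bar>)"
      by (rule sum_abs)
    also have "\<dots> \<le> (\<Sum>k<N. M - (if k = i then M else 0))"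
      by (intro sum_mono) (use le that diag in auto)
    also have "\<dots> = (real N - 1) * M"
      using that by (simp add: sum_subtractf algebra_simps)
    finally show ?thesis .
  qed
  have "M \<le> \<epsilon>"
  proof (cases "a = b")
    case True
    then show ?thesis
      using ab diag assms(4) by simp
  next
    case False
    have "\<bar>2 * real N * D a b\<bar> = 2 * (real N * M)"
      by (simp add: abs_mult ab(3))
    moreover have "\<bar>2 * real N * D a b\<bar> \<le> \<epsilon> + (real N - 1) * M + (real N - 1) * M"
      using eq[OF ab(1,2) False] row[OF ab(1)] row[OF ab(2)] by linarith
    ultimately have "2 * M \<le> \<epsilon>"
      by (simp add: algebra_simps)
    then show ?thesis
      using ab(3) by linarith
  qed
  then show ?thesis
    using le[OF assms(5,6)] by linarith
qed


section \<open>Cells of the gasket\<close>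

lemma F_word_append: "F_word p (v @ w) = F_word p v \<circ> F_word p w"
  by (induction v) (auto simp: fun_eq_iff)

lemma dist_F_word: "dist (F_word p w x) (F_word p w y) = dist x y / 2 ^ length w"
  by (induction w) (auto simp: dist_F_map)

lemma inj_F_map: "inj (F_map p i)"
  by (rule injI) (metis dist_F_map dist_eq_0_iff divide_eq_0_iff zero_neq_numeral)

lemma F_map_fixed [simp]: "F_map p i (p i) = p i"
  by (simp add: F_map_def)

lemma F_map_avg: "F_map p i x = (1/2) *\<^sub>R x + (1/2) *\<^sub>R p i"
proof -
  have "F_map p i x = (1/2) *\<^sub>R x + (p i - (1/2) *\<^sub>R p i)"
    by (simp add: F_map_def scaleR_diff_right)
  also have "p i - (1/2) *\<^sub>R p i = (1/2) *\<^sub>R p i"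
    using scaleR_left_diff_distrib[of 1 "1/2" "p i"] by simp
  finally show ?thesis .
qed

lemma F_map_vertex_sym: "F_map p i (p j) = F_map p j (p i)"
  by (simp add: F_map_avg add.commute)

lemma words_0 [simp]: "words N 0 = {[]}"
  by (auto simp: words_def)

lemma words_Suc: "words N (Suc m) = (\<lambda>(i, w). i # w) ` ({..<N} \<times> words N m)"
  by (auto simp: words_def length_Suc_conv image_iff)

lemma finite_words [simp]: "finite (words N m)"
  by (induction m) (auto simp: words_Suc)

lemma sum_words_Suc: "(\<Sum>w\<in>words N (Suc m). f w) = (\<Sum>i<N. \<Sum>w\<in>words N m. f (i # w))"
proof -
  have "inj_on (\<lambda>(i, w). i # w) ({..<N} \<times> words N m)"
    by (auto simp: inj_on_def)
  then show ?thesis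
    unfolding words_Suc by (simp add: sum.reindex sum.cartesian_product case_prod_unfold)
qed

lemma Cons_in_words: "i # w \<in> words N m \<longleftrightarrow> i < N \<and> w \<in> words N (m - 1) \<and> m > 0"
  by (cases m) (auto simp: words_Suc image_iff)

locale gasket =
  fixes N :: nat and p :: "nat \<Rightarrow> 'a::euclidean_space"
  assumes N_ge_2: "N \<ge> 2" and simplex: "regular_simplex N p"
begin

abbreviation K :: "'a set" where "K \<equiv> SG N p"

lemma N_pos: "N > 0" "real N > 0"
  using N_ge_2 by auto

lemma gasket_K: "K \<noteq> {}" "compact K" "K = (\<Union>j<N. F_map p j ` K)"
  using is_gasket_SG[of N p] N_pos by (auto simp: is_gasket_def)

lemma F_map_in_K: "i < N \<Longrightarrow> x \<in> K \<Longrightarrow> F_map p i x \<in> K"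
  using gasket_K(3) by blast

lemma K_cases:
  assumes "x \<in> K"
  obtains i y where "i < N" "y \<in> K" "x = F_map p i y"
  using gasket_K(3) assms by blast

lemma F_word_in_K: "w \<in> words N m \<Longrightarrow> x \<in> K \<Longrightarrow> F_word p w x \<in> K"
  by (induction w arbitrary: m) (auto simp: Cons_in_words F_map_in_K)

lemma K_word_cases:
  assumes "x \<in> K"
  shows "\<exists>w\<in>words N m. \<exists>y\<in>K. x = F_word p w y"
  using assms
proof (induction m arbitrary: x)
  case (Suc m)
  from K_cases[OF Suc.prems] obtain i y where iy: "i < N" "y \<in> K" "x = F_map p i y" .
  from Suc.IH[OF iy(2)] obtain w z where "w \<in> words N m" "z \<in> K" "y = F_word p w z" by blast
  with iy show ?case
    by (intro bexI[of _ "i # w"] bexI[of _ z]) (auto simp: Cons_in_words)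
qed auto

lemma vertex_in_K:
  assumes "i < N"
  shows "p i \<in> K"
proof -
  have "continuous_on K (\<lambda>x. dist x (p i))"
    by (intro continuous_intros)
  then obtain x where x: "x \<in> K" "\<And>y. y \<in> K \<Longrightarrow> dist x (p i) \<le> dist y (p i)"
    using continuous_attains_inf[OF gasket_K(2,1)] by blast
  have "dist x (p i) \<le> dist (F_map p i x) (F_map p i (p i))"
    using x(2)[OF F_map_in_K[OF assms x(1)]] by simp
  then have "dist x (p i) \<le> 0"
    unfolding dist_F_map by simp
  then show ?thesis
    using x(1) by simp
qed

definition centre :: 'a where "centre = (1 / real N) *\<^sub>R (\<Sum>k<N. p k)"

text \<open>
  Barycentric coordinates. The formula rests on the Gram matrix of the vectors \<open>p j - centre\<close>, which
  is half the projection onto the vectors of mean zero.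
\<close>

definition bary :: "nat \<Rightarrow> 'a \<Rightarrow> real" where
  "bary j x = 1 / real N + 2 * ((x - centre) \<bullet> (p j - centre))"

lemma inner_centre:
  assumes "j < N" "k < N"
  shows "2 * ((p k - centre) \<bullet> (p j - centre)) = of_bool (j = k) - 1 / real N"
proof -
  define q where "q j = p j - centre" for j
  have q0: "(\<Sum>j<N. q j) = 0"
    using N_pos by (simp add: q_def sum_subtractf sum_constant_scaleR centre_def)
  have d: "2 * (q j \<bullet> q k) = q j \<bullet> q j + q k \<bullet> q k - of_bool (j \<noteq> k)" if "j < N" "k < N" for j k
  proof -
    have "norm (q j - q k) = of_bool (j \<noteq> k)"
      using simplex that by (auto simp: q_def regular_simplex_def dist_norm)
    then have "(q j - q k) \<bullet> (q j - q k) = of_bool (j \<noteq> k)"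
      by (auto simp: norm_eq_sqrt_inner split: if_splits)
    then show ?thesis
      by (simp add: inner_diff_left inner_diff_right inner_commute)
  qed
  have row: "real N * (q j \<bullet> q j) + (\<Sum>k<N. q k \<bullet> q k) = real N - 1" if "j < N" for j
  proof -
    have "(\<Sum>k<N. 2 * (q j \<bullet> q k)) = 0"
      by (simp add: q0 flip: inner_sum_right sum_distrib_left)
    moreover have "(\<Sum>k<N. 2 * (q j \<bullet> q k)) = (\<Sum>k<N. q j \<bullet> q j + q k \<bullet> q k - of_bool (j \<noteq> k))"
      using that by (intro sum.cong) (auto simp: d)
    moreover have "(\<Sum>k<N. of_bool (j \<noteq> k) :: real) = real N - 1"
    proof -
      have "(\<Sum>k<N. of_bool (j \<noteq> k) :: real) = (\<Sum>k<N. 1 - (if j = k then 1 else 0))"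
        by (intro sum.cong) auto
      then show ?thesis
        using that by (simp add: sum_subtractf)
    qed
    ultimately show ?thesis
      by (simp add: sum_subtractf sum.distrib)
  qed
  define T where "T = (\<Sum>k<N. q k \<bullet> q k)"
  (* The row identity forces all norms to be equal, and summing it over j determines them. *)
  have r: "q j \<bullet> q j = (real N - 1 - T) / real N" if "j < N" for j
    using row[OF that] N_pos by (simp add: T_def field_simps)
  have "(\<Sum>k<N. q k \<bullet> q k) = (\<Sum>k<N. (real N - 1 - T) / real N)"
    by (rule sum.cong) (auto simp: r)
  then have "T = (\<Sum>k<N. (real N - 1 - T) / real N)"
    by (simp only: T_def[symmetric])
  then have T: "2 * T = real N - 1"
    using N_pos by simp
  have "2 * (q j \<bullet> q k) = 2 * ((real N - 1 - T) / real N) - of_bool (j \<noteq> k)"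
    using d[OF assms] r assms by simp
  also have "2 * ((real N - 1 - T) / real N) = (2 * real N - 2 - 2 * T) / real N"
    by simp
  also have "\<dots> = 1 - 1 / real N"
    unfolding T using N_pos by (simp add: field_simps)
  finally show ?thesis
    by (auto simp: q_def inner_commute)
qed

lemma bary_vertex:
  assumes "j < N" "k < N"
  shows "bary j (p k) = of_bool (j = k)"
  using inner_centre[OF assms] by (simp add: bary_def)

lemma sum_bary: "(\<Sum>j<N. bary j x) = 1"
proof -
  have "(\<Sum>j<N. p j - centre) = 0"
    using N_pos by (simp add: sum_subtractf sum_constant_scaleR centre_def)
  then have "(\<Sum>j<N. 2 * ((x - centre) \<bullet> (p j - centre))) = 0"
    by (simp flip: inner_sum_right sum_distrib_left)
  then show ?thesis
    using N_pos by (simp add: bary_def sum.distrib)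
qed

lemma bary_affine: "bary j ((1/2) *\<^sub>R x + (1/2) *\<^sub>R y) = (bary j x + bary j y) / 2"
proof -
  have half: "(1/2) *\<^sub>R centre + (1/2) *\<^sub>R centre = centre"
    by (simp flip: scaleR_left_distrib)
  have "((1/2) *\<^sub>R x + (1/2) *\<^sub>R y) - centre =
      ((1/2) *\<^sub>R x + (1/2) *\<^sub>R y) - ((1/2) *\<^sub>R centre + (1/2) *\<^sub>R centre)"
    by (simp only: half)
  also have "\<dots> = (1/2) *\<^sub>R (x - centre) + (1/2) *\<^sub>R (y - centre)"
    by (simp only: add_diff_add scaleR_diff_right)
  finally show ?thesis
    unfolding bary_def by (simp add: inner_add_left add_divide_distrib)
qed

lemma bary_F_map: "i < N \<Longrightarrow> j < N \<Longrightarrow> bary j (F_map p i x) = (bary j x + of_bool (i = j)) / 2"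
  by (auto simp: F_map_avg bary_affine bary_vertex)

lemma continuous_on_bary: "continuous_on A (bary j)"
  unfolding bary_def by (intro continuous_intros)

text \<open>
  Several properties of all points of the gasket come from an extremal argument. A continuous
  function \<open>g\<close> attains its minimum at some \<open>F_map p i y\<close>; if \<open>g (F_map p i y) \<ge> g y / 2\<close>, then the
  minimum is non-negative. Dually, \<open>g (F_map p i y) \<le> g y / 2\<close> makes the maximum non-positive.
\<close>

lemma bary_nonneg:
  assumes "x \<in> K" "j < N"
  shows "bary j x \<ge> 0"
proof -
  obtain m where m: "m \<in> K" "\<And>y. y \<in> K \<Longrightarrow> bary j m \<le> bary j y"
    using continuous_attains_inf[OF gasket_K(2,1) continuous_on_bary] by blast
  from K_cases[OF m(1)] obtain i y where iy: "i < N" "y \<in> K" "m = F_map p i y" .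
  have "bary j m \<ge> bary j y / 2"
    unfolding iy(3) bary_F_map[OF iy(1) assms(2)] by simp
  then have "bary j m \<ge> 0"
    using m(2)[OF iy(2)] by simp
  then show ?thesis
    using m(2)[OF assms(1)] by simp
qed

text \<open>
  The point with the barycentric coordinates of \<open>x\<close> is an affine function of \<open>x\<close> that commutes with
  each \<open>F_map p i\<close>. So its distance to \<open>x\<close> is halved by these maps.
\<close>

lemma bary_repr:
  assumes "x \<in> K"
  shows "x = (\<Sum>j<N. bary j x *\<^sub>R p j)"
proof -
  define r where "r x = (\<Sum>j<N. bary j x *\<^sub>R p j)" for x
  have r_F: "r (F_map p i x) = F_map p i (r x)" if "i < N" for i x
  proof -
    have "bary j (F_map p i x) *\<^sub>R p j =
        (1/2) *\<^sub>R (bary j x *\<^sub>R p j) + (if j = i then (1/2) *\<^sub>R p j else 0)" if "j < N" for j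
      unfolding bary_F_map[OF \<open>i < N\<close> that]
      by (simp add: scaleR_left_distrib add_divide_distrib)
    then have "r (F_map p i x) =
        (\<Sum>j<N. (1/2) *\<^sub>R (bary j x *\<^sub>R p j) + (if j = i then (1/2) *\<^sub>R p j else 0))"
      unfolding r_def by (intro sum.cong) auto
    also have "\<dots> = (1/2) *\<^sub>R r x + (1/2) *\<^sub>R p i"
      using that by (simp add: sum.distrib r_def scaleR_sum_right)
    finally show ?thesis
      by (simp only: F_map_avg[symmetric])
  qed
  have "continuous_on K (\<lambda>x. dist x (r x))"
    unfolding r_def by (intro continuous_intros continuous_on_bary)
  then obtain m where m: "m \<in> K" "\<And>y. y \<in> K \<Longrightarrow> dist y (r y) \<le> dist m (r m)"
    using continuous_attains_sup[OF gasket_K(2,1)] by blast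
  from K_cases[OF m(1)] obtain i y where iy: "i < N" "y \<in> K" "m = F_map p i y" .
  have "dist m (r m) = dist y (r y) / 2"
    by (simp add: iy(3) r_F[OF iy(1)] dist_F_map)
  then have "dist m (r m) \<le> 0"
    using m(2)[OF iy(2)] by linarith
  then have "dist x (r x) \<le> 0"
    using m(2)[OF assms] by linarith
  then have "x = r x"
    by simp
  then show ?thesis
    by (simp only: r_def)
qed

lemma K_vertex_unique:
  assumes "x \<in> K" "j < N" "bary j x = 1"
  shows "x = p j"
proof -
  have "bary j x + (\<Sum>k\<in>{..<N} - {j}. bary k x) = 1"
    using sum_bary[of x] assms(2) by (simp add: sum.remove)
  then have "(\<Sum>k\<in>{..<N} - {j}. bary k x) = 0"
    using assms(3) by simp
  then have zero: "bary k x = 0" if "k < N" "k \<noteq> j" for k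
    using that bary_nonneg[OF assms(1)] by (subst (asm) sum_nonneg_eq_0_iff) auto
  have "(\<Sum>k<N. bary k x *\<^sub>R p k) = (\<Sum>k<N. if k = j then p k else 0)"
    by (intro sum.cong) (auto simp: zero assms(3))
  then show ?thesis
    using bary_repr[OF assms(1)] assms(2) by simp
qed

text \<open>
  The coordinate of index \<open>i\<close> is at least \<open>1/2\<close> on the cell \<open>i\<close>, so at a common point of the cells
  \<open>i\<close> and \<open>j\<close> both coordinates are \<open>1/2\<close> and the others vanish.
\<close>

lemma overlap:
  assumes "i < N" "j < N" "i \<noteq> j" "x \<in> K" "y \<in> K" "F_map p i x = F_map p j y"
  shows "x = p j" "y = p i"
proof -
  have half: "bary i x + 1 = bary i y" "bary j x = bary j y + 1"
    using bary_F_map[of i i x] bary_F_map[of j i y] bary_F_map[of i j x] bary_F_map[of j j y] assms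
    by auto
  have le1: "bary k z \<le> 1" if "k < N" "z \<in> K" for k z
    using member_le_sum[of k "{..<N}" "\<lambda>k. bary k z"] sum_bary[of z] bary_nonneg that by auto
  have "bary j x = 1" "bary i y = 1"
    using half bary_nonneg[of x i] bary_nonneg[of y j] le1[of j x] le1[of i y] assms by auto
  then show "x = p j" "y = p i"
    using K_vertex_unique assms by auto
qed

lemma vertex_inj:
  assumes "i < N" "j < N" "p i = p j"
  shows "i = j"
  using bary_vertex[of i i] bary_vertex[of i j] assms by auto

lemma F_word_vertex_in_K: "w \<in> words N m \<Longrightarrow> j < N \<Longrightarrow> F_word p w (p j) \<in> K"
  by (auto intro: F_word_in_K vertex_in_K)

text \<open>
  Two different cells share at most one point, so an edge determines the cell containing it.
\<close>

lemma edge_unique: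
  assumes "v \<in> words N m" "w \<in> words N m" "i < N" "j < N" "i' < N" "j' < N" "i \<noteq> j"
    "F_word p v (p i) = F_word p w (p i')" "F_word p v (p j) = F_word p w (p j')"
  shows "v = w \<and> i = i' \<and> j = j'"
  using assms
proof (induction m arbitrary: v w)
  case 0
  then show ?case by (auto intro: vertex_inj)
next
  case (Suc m)
  from Suc.prems(1,2) obtain a v' b w' where v: "v = a # v'" "a < N" "v' \<in> words N m"
    and w: "w = b # w'" "b < N" "w' \<in> words N m"
    by (auto simp: words_Suc)
  have *: "F_map p a (F_word p v' (p i)) = F_map p b (F_word p w' (p i'))"
    "F_map p a (F_word p v' (p j)) = F_map p b (F_word p w' (p j'))"
    using Suc.prems v w by auto
  have "a = b"
  proof (rule ccontr)
    assume "a \<noteq> b"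
    then have "F_word p v' (p i) = F_word p v' (p j)"
      using overlap(1)[OF v(2) w(2) _ _ _ *(1)] overlap(1)[OF v(2) w(2) _ _ _ *(2)]
        F_word_vertex_in_K v w Suc.prems by metis
    then have "dist (p i) (p j) = 0"
      using dist_F_word[of p v' "p i" "p j"] by simp
    then show False
      using vertex_inj Suc.prems by auto
  qed
  moreover from this have "F_word p v' (p i) = F_word p w' (p i')" "F_word p v' (p j) = F_word p w' (p j')"
    using * inj_F_map by (auto dest: injD)
  ultimately show ?case
    using Suc.IH[of v' w'] Suc.prems v w by auto
qed

section \<open>Graph energies\<close>

abbreviation cell_vals :: "('a \<Rightarrow> real) \<Rightarrow> nat list \<Rightarrow> nat \<Rightarrow> real" where
  "cell_vals u w \<equiv> (\<lambda>j. u (F_word p w (p j)))"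

text \<open>
  An edge determines its cell and the two corners in it, so the sum over edges is a sum over words
  of level-zero energies.
\<close>

lemma energy_level_eq:
  "energy_level N p m u v =
    ((real N + 2) / real N) ^ m * (\<Sum>w\<in>words N m. form0 N (cell_vals u w) (cell_vals v w))"
proof -
  define J where "J = {(i, j). i < N \<and> j < N \<and> i \<noteq> j}"
  define e where "e = (\<lambda>(w, i, j). (F_word p w (p i), F_word p w (p j)))"
  define f where "f = (\<lambda>(x, y). (u x - u y) * (v x - v y))"
  have ne: "F_word p w (p i) \<noteq> F_word p w (p j)" if "i < N" "j < N" "i \<noteq> j" for w i j
    using dist_F_word[of p w "p i" "p j"] vertex_inj[of i j] that by auto
  have "{(x, y). adj N p m x y} = e ` (words N m \<times> J)"
  proof (intro set_eqI iffI)
    fix z assume "z \<in> {(x, y). adj N p m x y}"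
    then obtain x y w i j where "z = (x, y)" "x \<noteq> y" "w \<in> words N m" "i < N" "j < N"
      "x = F_word p w (p i)" "y = F_word p w (p j)"
      by (auto simp: adj_def V0_def)
    then have "(w, i, j) \<in> words N m \<times> J" "z = e (w, i, j)"
      by (auto simp: J_def e_def)
    then show "z \<in> e ` (words N m \<times> J)" by blast
  next
    fix z assume "z \<in> e ` (words N m \<times> J)"
    then obtain w i j where *: "w \<in> words N m" "i < N" "j < N" "i \<noteq> j"
      "z = (F_word p w (p i), F_word p w (p j))"
      by (auto simp: J_def e_def)
    then show "z \<in> {(x, y). adj N p m x y}"
      using ne[of i j w] by (auto simp: adj_def V0_def V_level_def)
  qed
  moreover have "inj_on e (words N m \<times> J)"
  proof (rule inj_onI)
    fix a b assume ab: "a \<in> words N m \<times> J" "b \<in> words N m \<times> J" "e a = e b"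
    obtain w i j w' i' j' where "a = (w, i, j)" "b = (w', i', j')"
      by (metis prod_cases3)
    then show "a = b"
      using ab edge_unique[of w m w' i j i' j'] by (auto simp: J_def e_def)
  qed
  ultimately have "(\<Sum>(x, y) \<in> {(x, y). adj N p m x y}. (u x - u y) * (v x - v y)) =
      (\<Sum>t\<in>words N m \<times> J. f (e t))"
    unfolding f_def by (simp add: sum.reindex)
  also have "\<dots> = (\<Sum>w\<in>words N m. \<Sum>z\<in>J. f (e (w, z)))"
    by (simp add: sum.cartesian_product case_prod_unfold)
  also have "\<dots> = (\<Sum>w\<in>words N m. 2 * form0 N (cell_vals u w) (cell_vals v w))"
  proof (rule sum.cong[OF refl])
    fix w
    have "(\<Sum>z\<in>J. f (e (w, z))) = (\<Sum>z\<in>{..<N} \<times> {..<N}. f (e (w, z)))"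
      by (rule sum.mono_neutral_left) (auto simp: J_def f_def e_def)
    then show "(\<Sum>z\<in>J. f (e (w, z))) = 2 * form0 N (cell_vals u w) (cell_vals v w)"
      by (simp add: form0_def f_def e_def sum.cartesian_product case_prod_unfold)
  qed
  finally show ?thesis
    by (simp add: energy_level_def flip: sum_distrib_left)
qed

lemma energy_level_0: "energy_level N p 0 u v = form0 N (\<lambda>j. u (p j)) (\<lambda>j. v (p j))"
  by (simp add: energy_level_eq)

lemma energy_level_Suc:
  "energy_level N p (Suc m) u v =
    (real N + 2) / real N * (\<Sum>i<N. energy_level N p m (u \<circ> F_map p i) (v \<circ> F_map p i))"
  by (simp add: energy_level_eq sum_words_Suc sum_distrib_left mult.assoc)

lemma energy_level_nonneg: "energy_level N p m u u \<ge> 0"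
  unfolding energy_level_eq by (intro mult_nonneg_nonneg sum_nonneg form0_nonneg) auto

lemma energy_level_cong:
  assumes "\<And>x. x \<in> K \<Longrightarrow> u x = u' x" "\<And>x. x \<in> K \<Longrightarrow> v x = v' x"
  shows "energy_level N p m u v = energy_level N p m u' v'"
  unfolding energy_level_eq
  by (intro arg_cong2[where f = "(*)"] sum.cong form0_cong refl assms F_word_vertex_in_K)


section \<open>Gluing and harmonic functions\<close>

text \<open>
  The map \<open>\<lambda>x. 2 *\<^sub>R x - p i\<close> inverts \<open>F_map p i\<close>. The least index is an arbitrary choice for points
  of two cells; there the pieces agree as soon as \<open>\<phi> i (p j) = \<phi> j (p i)\<close>.
\<close>

definition glue :: "(nat \<Rightarrow> 'a \<Rightarrow> real) \<Rightarrow> 'a \<Rightarrow> real" where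
  "glue \<phi> x = (let i = LEAST i. i < N \<and> x \<in> F_map p i ` K in \<phi> i (2 *\<^sub>R x - p i))"

lemma F_map_inverse: "2 *\<^sub>R F_map p i x - p i = x"
  by (simp add: F_map_avg scaleR_add_right)

lemma glue_F_map:
  assumes "\<And>i j. i < N \<Longrightarrow> j < N \<Longrightarrow> \<phi> i (p j) = \<phi> j (p i)" and "i < N" "x \<in> K"
  shows "glue \<phi> (F_map p i x) = \<phi> i x"
proof -
  define k where "k = (LEAST k. k < N \<and> F_map p i x \<in> F_map p k ` K)"
  have "k < N \<and> F_map p i x \<in> F_map p k ` K"
    unfolding k_def by (rule LeastI[of _ i]) (use assms in auto)
  then obtain y where k: "k < N" "y \<in> K" "F_map p i x = F_map p k y"
    by auto
  have "glue \<phi> (F_map p i x) = \<phi> k (2 *\<^sub>R F_map p k y - p k)"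
    unfolding glue_def Let_def k_def[symmetric] k(3)[symmetric] ..
  also have "\<dots> = \<phi> k y"
    by (simp only: F_map_inverse)
  also have "\<dots> = \<phi> i x"
  proof (cases "k = i")
    case True
    then show ?thesis using k(3) inj_F_map by (auto dest: injD)
  next
    case False
    then have "x = p k" "y = p i"
      using overlap[of i k x y] k assms(2,3) by auto
    then show ?thesis
      using assms(1)[OF k(1) assms(2)] by simp
  qed
  finally show ?thesis .
qed

lemma continuous_on_glue:
  assumes sym: "\<And>i j. i < N \<Longrightarrow> j < N \<Longrightarrow> \<phi> i (p j) = \<phi> j (p i)"
    and cont: "\<And>i. i < N \<Longrightarrow> continuous_on K (\<phi> i)"
  shows "continuous_on K (glue \<phi>)"
proof -
  have "continuous_on (\<Union>i<N. F_map p i ` K) (glue \<phi>)"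
  proof (rule continuous_on_closed_Union)
    fix i assume i: "i \<in> {..<N}"
    show "closed (F_map p i ` K)"
      by (intro compact_imp_closed compact_continuous_image continuous_on_F_map gasket_K)
    have "continuous_on (F_map p i ` K) (\<phi> i \<circ> (\<lambda>x. 2 *\<^sub>R x - p i))"
    proof (rule continuous_on_compose)
      have "(\<lambda>x. 2 *\<^sub>R x - p i) ` F_map p i ` K = K"
        by (simp add: image_image F_map_inverse)
      then show "continuous_on ((\<lambda>x. 2 *\<^sub>R x - p i) ` F_map p i ` K) (\<phi> i)"
        using cont i by simp
    qed (intro continuous_intros)
    moreover have "(\<phi> i \<circ> (\<lambda>x. 2 *\<^sub>R x - p i)) x = glue \<phi> x" if "x \<in> F_map p i ` K" for x
      using that i by (auto simp: F_map_inverse glue_F_map[of \<phi>, OF sym])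
    ultimately show "continuous_on (F_map p i ` K) (glue \<phi>)"
      by (simp cong: continuous_on_cong)
  qed simp
  then show ?thesis
    using gasket_K(3) by simp
qed

text \<open>
  Harmonic functions are obtained as limits: \<open>approx m b\<close> has the harmonic values at the vertices of
  level \<open>m\<close> and interpolates barycentrically on each cell of that level.
\<close>

primrec approx :: "nat \<Rightarrow> (nat \<Rightarrow> real) \<Rightarrow> 'a \<Rightarrow> real" where
  "approx 0 = (\<lambda>b x. \<Sum>j<N. b j * bary j x)"
| "approx (Suc m) = (\<lambda>b. glue (\<lambda>i. approx m (cell_ext N i b)))"

lemma approx_0_vertex: "j < N \<Longrightarrow> (\<Sum>k<N. b k * bary k (p j)) = b j"
proof -
  assume "j < N"
  then have "(\<Sum>k<N. b k * bary k (p j)) = (\<Sum>k<N. if k = j then b j else 0)"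
    by (intro sum.cong) (auto simp: bary_vertex)
  then show ?thesis
    using \<open>j < N\<close> by simp
qed

lemma approx_vertex: "j < N \<Longrightarrow> approx m b (p j) = b j"
proof (induction m arbitrary: b j)
  case 0
  then show ?case by (simp add: approx_0_vertex)
next
  case (Suc m)
  have "glue (\<lambda>i. approx m (cell_ext N i b)) (F_map p j (p j)) = approx m (cell_ext N j b) (p j)"
    by (rule glue_F_map) (use Suc vertex_in_K cell_ext_sym in auto)
  then show ?case
    using Suc by simp
qed

lemma approx_glue_sym:
  "i < N \<Longrightarrow> j < N \<Longrightarrow> approx m (cell_ext N i b) (p j) = approx m (cell_ext N j b) (p i)"
  by (simp add: approx_vertex cell_ext_sym[of N i])

lemma approx_F_map:
  assumes "i < N" "x \<in> K"
  shows "approx (Suc m) b (F_map p i x) = approx m (cell_ext N i b) x"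
  using glue_F_map[of "\<lambda>i. approx m (cell_ext N i b)", OF approx_glue_sym assms] by simp

lemma continuous_on_approx: "continuous_on K (approx m b)"
proof (induction m arbitrary: b)
  case 0
  show ?case
    by (simp, intro continuous_intros continuous_on_bary)
next
  case (Suc m)
  show ?case
    using continuous_on_glue[of "\<lambda>i. approx m (cell_ext N i b)", OF approx_glue_sym Suc] by simp
qed

lemma approx_linear:
  assumes "x \<in> K"
  shows "approx m (\<lambda>j. s * b j + t * c j) x = s * approx m b x + t * approx m c x"
  using assms
proof (induction m arbitrary: b c x)
  case 0
  show ?case
    by (simp add: sum.distrib sum_distrib_left algebra_simps)
next
  case (Suc m)
  from K_cases[OF Suc.prems] obtain i y where "i < N" "y \<in> K" "x = F_map p i y" .
  then show ?case
    by (simp add: approx_F_map cell_ext_linear Suc.IH del: approx.simps)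
qed

lemma approx_const: "x \<in> K \<Longrightarrow> approx m (\<lambda>_. t) x = t"
proof (induction m arbitrary: x)
  case 0
  show ?case
    by (simp add: sum_bary flip: sum_distrib_left)
next
  case (Suc m)
  from K_cases[OF Suc.prems] obtain i y where "i < N" "y \<in> K" "x = F_map p i y" .
  then show ?case
    by (simp add: approx_F_map cell_ext_const Suc.IH del: approx.simps)
qed

lemma convex_bound:
  assumes "x \<in> K" "\<And>j. j < N \<Longrightarrow> \<bar>b j - t\<bar> \<le> B"
  shows "\<bar>(\<Sum>j<N. b j * bary j x) - t\<bar> \<le> B"
proof -
  have "(\<Sum>j<N. b j * bary j x) - t = (\<Sum>j<N. (b j - t) * bary j x)"
    by (simp add: left_diff_distrib sum_subtractf sum_bary flip: sum_distrib_left)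
  also have "\<bar>\<dots>\<bar> \<le> (\<Sum>j<N. \<bar>(b j - t) * bary j x\<bar>)"
    by (rule sum_abs)
  also have "\<dots> \<le> (\<Sum>j<N. B * bary j x)"
  proof (rule sum_mono)
    fix j assume "j \<in> {..<N}"
    then show "\<bar>(b j - t) * bary j x\<bar> \<le> B * bary j x"
      using assms bary_nonneg[of x j] by (simp add: abs_mult mult_right_mono)
  qed
  also have "\<dots> = B"
    by (simp add: sum_bary flip: sum_distrib_left)
  finally show ?thesis .
qed

text \<open>
  Both functions stay in a cell of level \<open>m\<close> within the oscillation of its boundary values, and the
  energy of these values shrinks at least by the factor \<open>N / (N + 2)\<close> with each level.
\<close>

lemma approx_step:
  assumes "x \<in> K"
  shows "\<bar>approx (Suc m) b x - approx m b x\<bar>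
    \<le> 2 * sqrt (form0 N b b) * sqrt (real N / (real N + 2)) ^ m"
  using assms
proof (induction m arbitrary: b x)
  case 0
  from K_cases[OF 0] obtain i y where iy: "i < N" "y \<in> K" "x = F_map p i y" .
  let ?c = "cell_ext N i b"
  have "form0 N ?c ?c \<le> real N / (real N + 2) * form0 N b b"
    by (rule form0_cell_ext_le[OF iy(1)])
  also have "\<dots> \<le> 1 * form0 N b b"
    by (intro mult_right_mono form0_nonneg) (use N_pos in auto)
  finally have "sqrt (form0 N ?c ?c) \<le> sqrt (form0 N b b)"
    by simp
  then have "\<bar>?c j - b i\<bar> \<le> sqrt (form0 N b b)" if "j < N" for j
    using abs_diff_le_form0[OF that iy(1), of ?c] by (simp only: cell_ext_diag)
  then have "\<bar>approx (Suc 0) b x - b i\<bar> \<le> sqrt (form0 N b b)"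
    unfolding iy(3) approx_F_map[OF iy(1,2)] approx.simps(1) by (intro convex_bound iy(2))
  moreover have "\<bar>approx 0 b x - b i\<bar> \<le> sqrt (form0 N b b)"
    unfolding approx.simps(1) using iy(1) by (intro convex_bound 0 abs_diff_le_form0)
  ultimately have "\<bar>approx (Suc 0) b x - approx 0 b x\<bar> \<le> sqrt (form0 N b b) + sqrt (form0 N b b)"
    by linarith
  then show ?case
    by simp
next
  case (Suc m)
  from K_cases[OF Suc.prems] obtain i y where iy: "i < N" "y \<in> K" "x = F_map p i y" .
  let ?c = "cell_ext N i b" and ?r = "real N / (real N + 2)"
  have "\<bar>approx (Suc (Suc m)) b x - approx (Suc m) b x\<bar> = \<bar>approx (Suc m) ?c y - approx m ?c y\<bar>"
    using iy by (simp only: approx_F_map)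
  also have "\<dots> \<le> 2 * sqrt (form0 N ?c ?c) * sqrt ?r ^ m"
    by (rule Suc.IH[OF iy(2)])
  also have "\<dots> \<le> 2 * sqrt (?r * form0 N b b) * sqrt ?r ^ m"
    by (intro mult_right_mono mult_left_mono real_sqrt_le_mono form0_cell_ext_le iy(1)) auto
  also have "\<dots> = 2 * sqrt (form0 N b b) * sqrt ?r ^ Suc m"
    unfolding real_sqrt_mult by (simp only: power_Suc mult_ac)
  finally show ?case .
qed

definition hext :: "(nat \<Rightarrow> real) \<Rightarrow> 'a \<Rightarrow> real" where
  "hext b x = lim (\<lambda>m. approx m b x)"

lemma approx_uniform_limit: "uniform_limit K (\<lambda>m. approx m b) (hext b) sequentially"
proof -
  define f where "f m x = approx (Suc m) b x - approx m b x" for m x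
  have "uniform_limit K (\<lambda>n x. \<Sum>i<n. f i x) (\<lambda>x. suminf (\<lambda>i. f i x)) sequentially"
  proof (rule Weierstrass_m_test)
    show "norm (f n x) \<le> 2 * sqrt (form0 N b b) * sqrt (real N / (real N + 2)) ^ n" if "x \<in> K" for n x
      unfolding f_def real_norm_def by (rule approx_step[OF that])
    have "real N / (real N + 2) < 1"
      using N_pos by simp
    then have "sqrt (real N / (real N + 2)) < 1"
      by (subst real_sqrt_lt_1_iff)
    then show "summable (\<lambda>n. 2 * sqrt (form0 N b b) * sqrt (real N / (real N + 2)) ^ n)"
      by (intro summable_mult summable_geometric) simp
  qed
  then have "uniform_limit K (\<lambda>n x. (\<Sum>i<n. f i x) + approx 0 b x)
      (\<lambda>x. suminf (\<lambda>i. f i x) + approx 0 b x) sequentially"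
    by (intro uniform_limit_add uniform_limit_const)
  moreover have "(\<Sum>i<n. f i x) + approx 0 b x = approx n b x" for n x
    unfolding f_def by (subst sum_lessThan_telescope) simp
  ultimately have lim: "uniform_limit K (\<lambda>n. approx n b) (\<lambda>x. suminf (\<lambda>i. f i x) + approx 0 b x) sequentially"
    by simp
  have "hext b x = suminf (\<lambda>i. f i x) + approx 0 b x" if "x \<in> K" for x
    unfolding hext_def by (rule limI) (rule tendsto_uniform_limitI[OF lim that])
  then show ?thesis
    using lim by (simp cong: uniform_limit_cong')
qed

lemma approx_tendsto: "x \<in> K \<Longrightarrow> (\<lambda>m. approx m b x) \<longlonglongrightarrow> hext b x"
  by (rule tendsto_uniform_limitI[OF approx_uniform_limit])

lemma continuous_on_hext: "continuous_on K (hext b)"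
  by (rule uniform_limit_theorem[OF _ approx_uniform_limit]) (auto simp: continuous_on_approx)

lemma hext_vertex: "j < N \<Longrightarrow> hext b (p j) = b j"
  using approx_tendsto[OF vertex_in_K, of j b] by (simp add: approx_vertex LIMSEQ_const_iff)

lemma hext_F_map:
  assumes "i < N" "x \<in> K"
  shows "hext b (F_map p i x) = hext (cell_ext N i b) x"
proof -
  have "(\<lambda>m. approx (Suc m) b (F_map p i x)) \<longlonglongrightarrow> hext b (F_map p i x)"
    by (rule LIMSEQ_Suc[OF approx_tendsto[OF F_map_in_K[OF assms]]])
  then have "(\<lambda>m. approx m (cell_ext N i b) x) \<longlonglongrightarrow> hext b (F_map p i x)"
    by (simp only: approx_F_map[OF assms])
  then show ?thesis
    using approx_tendsto[OF assms(2)] LIMSEQ_unique by blast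
qed

lemma hext_linear:
  assumes "x \<in> K"
  shows "hext (\<lambda>j. s * b j + t * c j) x = s * hext b x + t * hext c x"
proof -
  have "(\<lambda>m. approx m (\<lambda>j. s * b j + t * c j) x) \<longlonglongrightarrow> s * hext b x + t * hext c x"
    unfolding approx_linear[OF assms] by (intro tendsto_intros approx_tendsto assms)
  then show ?thesis
    using approx_tendsto[OF assms] LIMSEQ_unique by blast
qed

lemma hext_const: "x \<in> K \<Longrightarrow> hext (\<lambda>_. t) x = t"
  using approx_tendsto[of x "\<lambda>_. t"] by (simp add: approx_const LIMSEQ_const_iff)

lemma approx_cong:
  assumes "x \<in> K" "\<And>j. j < N \<Longrightarrow> b j = c j"
  shows "approx m b x = approx m c x"
  using assms
proof (induction m arbitrary: b c x)
  case (Suc m)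
  from K_cases[OF Suc.prems(1)] obtain i y where "i < N" "y \<in> K" "x = F_map p i y" .
  then show ?case
    using Suc.IH[of y "cell_ext N i b" "cell_ext N i c"] Suc.prems(2) cell_ext_cong[of i N b c]
    by (simp add: approx_F_map del: approx.simps)
qed simp

lemma hext_cong:
  assumes "x \<in> K" "\<And>j. j < N \<Longrightarrow> b j = c j"
  shows "hext b x = hext c x"
  unfolding hext_def using approx_cong[OF assms] by simp

text \<open>
  On every level, the energy against a harmonic function sees only boundary values. In particular
  harmonic functions are orthogonal to functions vanishing on the boundary.
\<close>

lemma energy_level_hext:
  "energy_level N p m (hext b) v = form0 N b (\<lambda>j. v (p j))"
proof (induction m arbitrary: b v)
  case 0
  show ?case
    unfolding energy_level_0 by (rule form0_cong) (auto simp: hext_vertex)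
next
  case (Suc m)
  have "energy_level N p (Suc m) (hext b) v =
      (real N + 2) / real N * (\<Sum>i<N. energy_level N p m (hext b \<circ> F_map p i) (v \<circ> F_map p i))"
    by (rule energy_level_Suc)
  also have "(\<Sum>i<N. energy_level N p m (hext b \<circ> F_map p i) (v \<circ> F_map p i)) =
      (\<Sum>i<N. energy_level N p m (hext (cell_ext N i b)) (v \<circ> F_map p i))"
    by (intro sum.cong refl energy_level_cong) (auto simp: hext_F_map)
  also have "\<dots> = (\<Sum>i<N. form0 N (cell_ext N i b) (\<lambda>j. v (F_map p i (p j))))"
    by (simp add: Suc.IH)
  also have "(real N + 2) / real N * \<dots> = form0 N b (\<lambda>i. v (F_map p i (p i)))"
    by (rule cell_ext_harmonic) (auto simp: N_pos intro: arg_cong[OF F_map_vertex_sym])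
  finally show ?case
    by simp
qed

lemma energy_level_commute: "energy_level N p m u v = energy_level N p m v u"
  by (simp add: energy_level_eq form0_commute[of N "cell_vals u _"])

lemma energy_level_add_left:
  "energy_level N p m (\<lambda>x. u x + u' x) v = energy_level N p m u v + energy_level N p m u' v"
  by (simp add: energy_level_eq form0_add_left sum.distrib distrib_left)

lemma zero_of_vertices:
  fixes g :: "'a \<Rightarrow> real"
  assumes "continuous_on K g" "\<And>m w j. w \<in> words N m \<Longrightarrow> j < N \<Longrightarrow> g (F_word p w (p j)) = 0" "x \<in> K"
  shows "g x = 0"
proof -
  obtain D where D: "\<And>y z. y \<in> K \<Longrightarrow> z \<in> K \<Longrightarrow> dist y z \<le> D"
    using compact_imp_bounded[OF gasket_K(2)] bounded_two_points by metis
  have "\<exists>w\<in>words N m. \<exists>y\<in>K. x = F_word p w y" for m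
    by (rule K_word_cases[OF assms(3)])
  then obtain w y where w: "\<And>m. w m \<in> words N m" "\<And>m. y m \<in> K" "\<And>m. x = F_word p (w m) (y m)"
    by metis
  define z where "z m = F_word p (w m) (p 0)" for m
  have z: "z m \<in> K" "g (z m) = 0" for m
    using F_word_vertex_in_K[OF w(1)] assms(2)[OF w(1)] N_pos by (auto simp: z_def)
  have "z \<longlonglongrightarrow> x"
  proof (rule metric_tendsto_imp_tendsto)
    show "(\<lambda>m. D * (1/2) ^ m) \<longlonglongrightarrow> 0"
      by (intro tendsto_mult_right_zero LIMSEQ_power_zero) simp
    show "eventually (\<lambda>m. dist (z m) x \<le> dist (D * (1/2) ^ m) 0) sequentially"
    proof (intro always_eventually allI)
      fix m
      have "dist (z m) x = dist (p 0) (y m) / 2 ^ m"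
        using dist_F_word[of p "w m" "p 0" "y m"] w(1)[of m] unfolding z_def w(3)[of m, symmetric]
        by (simp add: words_def)
      also have "\<dots> \<le> D / 2 ^ m"
        by (intro divide_right_mono D vertex_in_K N_pos w) simp
      also have "\<dots> \<le> dist (D * (1/2) ^ m) 0"
        by (simp add: power_one_over divide_right_mono)
      finally show "dist (z m) x \<le> dist (D * (1/2) ^ m) 0" .
    qed
  qed
  then have "(g \<circ> z) \<longlonglongrightarrow> g x"
    using assms(1,3) z(1) unfolding continuous_on_sequentially by blast
  moreover have "g \<circ> z = (\<lambda>_. 0)"
    by (simp add: fun_eq_iff z)
  ultimately have "(\<lambda>_. 0) \<longlonglongrightarrow> g x"
    by simp
  then have "0 = g x"
    by (rule LIMSEQ_unique[OF tendsto_const])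
  then show ?thesis ..
qed

text \<open>
  Energy zero on level one makes \<open>g\<close> constant on the corners of each cell \<open>i\<close>, one of which is the
  boundary point \<open>p i\<close>. So \<open>g\<close> vanishes on the boundary of each cell, and the argument can be
  repeated inside the cells.
\<close>

lemma zero_of_energy:
  assumes "\<And>j. j < N \<Longrightarrow> g (p j) = 0" "\<And>m. energy_level N p m g g = 0" "w \<in> words N m" "j < N"
  shows "g (F_word p w (p j)) = 0"
  using assms
proof (induction m arbitrary: g w)
  case 0
  then show ?case by simp
next
  case (Suc m)
  from Suc.prems(3) obtain i w' where w: "w = i # w'" "i < N" "w' \<in> words N m"
    by (auto simp: words_Suc)
  have cell: "energy_level N p n (g \<circ> F_map p i) (g \<circ> F_map p i) = 0" for n
  proof -
    have "(\<Sum>i<N. energy_level N p n (g \<circ> F_map p i) (g \<circ> F_map p i)) = 0"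
      using Suc.prems(2)[of "Suc n"] N_pos unfolding energy_level_Suc by simp
    then show ?thesis
      using w(2) by (subst (asm) sum_nonneg_eq_0_iff) (auto simp: energy_level_nonneg)
  qed
  have "(g \<circ> F_map p i) (p k) = 0" if "k < N" for k
  proof -
    have "(g \<circ> F_map p i) (p k) = (g \<circ> F_map p i) (p i)"
      using cell[of 0] that w(2) unfolding energy_level_0 form0_eq_0_iff by blast
    then show ?thesis
      using Suc.prems(1)[OF w(2)] by simp
  qed
  then have "(g \<circ> F_map p i) (F_word p w' (p j)) = 0"
    using cell w(3) Suc.prems(4) by (rule Suc.IH)
  then show ?case
    by (simp add: w(1))
qed

text \<open>
  Both directions are the theorem of Pythagoras for the orthogonal decomposition of a function into
  the harmonic one with the same boundary values and a remainder that vanishes on the boundary.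
\<close>

lemma harmonic_iff: "g \<in> harmonic N p \<longleftrightarrow> (\<forall>x\<in>K. g x = hext (\<lambda>j. g (p j)) x)"
proof
  assume g: "g \<in> harmonic N p"
  define b where "b j = g (p j)" for j
  define d where "d x = g x - hext b x" for x
  have d0: "d (p j) = 0" if "j < N" for j
    using that by (simp add: d_def b_def hext_vertex)
  have hd: "energy_level N p m (hext b) d = 0" for m
    unfolding energy_level_hext using d0 form0_cong[of N b b "\<lambda>j. d (p j)" "\<lambda>_. 0"]
    by (simp add: form0_def)
  have "energy_level N p m d d = 0" for m
  proof (cases m)
    case 0
    then show ?thesis
      unfolding 0 energy_level_0
      using d0 form0_cong[of N "\<lambda>j. d (p j)" "\<lambda>_. 0" "\<lambda>j. d (p j)" "\<lambda>_. 0"] by (simp add: form0_def)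
  next
    case (Suc n)
    have "\<forall>x\<in>V0 N p. hext b x = g x"
      by (auto simp: V0_def hext_vertex b_def)
    then have "energy_level N p m g g \<le> energy_level N p m (hext b) (hext b)"
      using g Suc by (auto simp: harmonic_def)
    moreover have "g = (\<lambda>x. hext b x + d x)"
      by (simp add: d_def)
    then have "energy_level N p m g g = energy_level N p m (\<lambda>x. hext b x + d x) (\<lambda>x. hext b x + d x)"
      by simp
    then have "energy_level N p m g g = energy_level N p m (hext b) (hext b)
        + 2 * energy_level N p m (hext b) d + energy_level N p m d d"
      unfolding energy_level_add_left energy_level_commute[of m _ "\<lambda>x. hext b x + d x"]
      by (simp add: energy_level_commute[of m d "hext b"])
    ultimately have "energy_level N p m d d \<le> 0"
      using hd[of m] by linarith
    then show ?thesis
      using energy_level_nonneg[of m d] by simp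
  qed
  then have "d (F_word p w (p j)) = 0" if "w \<in> words N m" "j < N" for w m j
    using zero_of_energy[of d, OF d0] that by blast
  moreover have "continuous_on K d"
    unfolding d_def using g
    by (intro continuous_intros continuous_on_hext) (auto simp: harmonic_def dom_energy_def)
  ultimately have "d x = 0" if "x \<in> K" for x
    using zero_of_vertices[of d] that by blast
  moreover have "b = (\<lambda>j. g (p j))"
    by (simp add: b_def fun_eq_iff)
  ultimately show "\<forall>x\<in>K. g x = hext (\<lambda>j. g (p j)) x"
    by (simp only: d_def right_minus_eq) simp
next
  define b where "b j = g (p j)" for j
  assume "\<forall>x\<in>K. g x = hext (\<lambda>j. g (p j)) x"
  then have g: "g x = hext b x" if "x \<in> K" for x
    using that by (simp add: b_def[abs_def])
  have energy: "energy_level N p m g v = form0 N b (\<lambda>j. v (p j))" for m v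
    using energy_level_cong[of g "hext b" v v m] energy_level_hext g by simp
  have "g \<in> dom_energy N p"
    using continuous_on_hext[of b] g
    by (auto simp: dom_energy_def energy convergent_const cong: continuous_on_cong)
  moreover have "energy_level N p n g g \<le> energy_level N p n f f" if f: "\<forall>x\<in>V0 N p. f x = g x" for n f
  proof -
    define d where "d x = f x - g x" for x
    have "energy_level N p n g d = 0"
      unfolding energy using f form0_cong[of N b b "\<lambda>j. d (p j)" "\<lambda>_. 0"]
      by (simp add: form0_def d_def V0_def)
    moreover have "f = (\<lambda>x. g x + d x)"
      by (simp add: d_def)
    then have "energy_level N p n f f = energy_level N p n (\<lambda>x. g x + d x) (\<lambda>x. g x + d x)"
      by simp
    then have "energy_level N p n f f = energy_level N p n g g
        + 2 * energy_level N p n g d + energy_level N p n d d"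
      unfolding energy_level_add_left energy_level_commute[of n _ "\<lambda>x. g x + d x"]
      by (simp add: energy_level_commute[of n d g])
    ultimately show ?thesis
      using energy_level_nonneg[of n d] by simp
  qed
  ultimately show "g \<in> harmonic N p"
    by (auto simp: harmonic_def)
qed


section \<open>Harmonic functions modulo constants\<close>

text \<open>
  A class of harmonic functions is represented by any of its vectors of boundary values. Two vectors
  represent the same class iff their difference has square norm zero, so each operation on classes
  turns into a matrix acting on vectors.
\<close>

abbreviation sqn :: "(nat \<Rightarrow> real) \<Rightarrow> real" where "sqn b \<equiv> form0 N b b"

lemma sqn_diff_trans:
  assumes "sqn (\<lambda>j. a j - b j) = 0" "sqn (\<lambda>j. b j - c j) = 0"
  shows "sqn (\<lambda>j. a j - c j) = 0"
  unfolding form0_eq_0_iff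
proof (intro allI impI)
  fix j k assume "j < N" "k < N"
  then have "a j - b j = a k - b k" "b j - c j = b k - c k"
    using assms unfolding form0_eq_0_iff by blast+
  then show "a j - c j = a k - c k" by linarith
qed

lemma sqn_diff_commute: "sqn (\<lambda>j. a j - b j) = sqn (\<lambda>j. b j - a j)"
  by (simp add: form0_def algebra_simps)

lemma sqn_cong_diff:
  assumes "sqn (\<lambda>j. a j - b j) = 0"
  shows "sqn a = sqn b"
proof -
  have "a j - a k = b j - b k" if "j < N" "k < N" for j k
  proof -
    have "a j - b j = a k - b k"
      using assms that unfolding form0_eq_0_iff by blast
    then show ?thesis by linarith
  qed
  then show ?thesis
    unfolding form0_def by (intro arg_cong2[where f = "(*)"] sum.cong refl) auto
qed

lemma hext_harmonic: "hext b \<in> harmonic N p"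
  unfolding harmonic_iff by (auto intro!: hext_cong simp: hext_vertex)

lemma harmonic_diff:
  assumes "g \<in> harmonic N p" "h \<in> harmonic N p"
  shows "(\<lambda>x. g x - h x) \<in> harmonic N p"
  unfolding harmonic_iff
proof
  fix x assume x: "x \<in> K"
  have "hext (\<lambda>j. g (p j) - h (p j)) x = hext (\<lambda>j. 1 * g (p j) + (-1) * h (p j)) x"
    by simp
  also have "\<dots> = hext (\<lambda>j. g (p j)) x - hext (\<lambda>j. h (p j)) x"
    unfolding hext_linear[OF x] by simp
  also have "\<dots> = g x - h x"
    using assms x unfolding harmonic_iff by simp
  finally show "g x - h x = hext (\<lambda>j. g (p j) - h (p j)) x" ..
qed

lemma harmonic_F_map_vertex:
  assumes "h \<in> harmonic N p" "i < N" "j < N"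
  shows "h (F_map p i (p j)) = cell_ext N i (\<lambda>j. h (p j)) j"
proof -
  have "h (F_map p i (p j)) = hext (\<lambda>j. h (p j)) (F_map p i (p j))"
    using assms F_map_in_K vertex_in_K unfolding harmonic_iff by blast
  also have "\<dots> = cell_ext N i (\<lambda>j. h (p j)) j"
    using assms by (simp add: hext_F_map vertex_in_K hext_vertex)
  finally show ?thesis .
qed

lemma harmonic_F_map:
  assumes "h \<in> harmonic N p" "i < N"
  shows "h \<circ> F_map p i \<in> harmonic N p"
  unfolding harmonic_iff
proof
  fix x assume x: "x \<in> K"
  have "(h \<circ> F_map p i) x = hext (\<lambda>j. h (p j)) (F_map p i x)"
    using assms x F_map_in_K unfolding harmonic_iff by simp
  also have "\<dots> = hext (cell_ext N i (\<lambda>j. h (p j))) x"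
    by (rule hext_F_map[OF assms(2) x])
  also have "\<dots> = hext (\<lambda>j. (h \<circ> F_map p i) (p j)) x"
    using assms by (intro hext_cong[OF x]) (simp add: harmonic_F_map_vertex)
  finally show "(h \<circ> F_map p i) x = hext (\<lambda>j. (h \<circ> F_map p i) (p j)) x" .
qed

lemma const_rel_iff:
  "(g, h) \<in> const_rel N p \<longleftrightarrow>
    g \<in> harmonic N p \<and> h \<in> harmonic N p \<and> sqn (\<lambda>j. g (p j) - h (p j)) = 0"
proof -
  have "(\<exists>c. \<forall>x\<in>K. g x - h x = c) \<longleftrightarrow> sqn (\<lambda>j. g (p j) - h (p j)) = 0"
    if gh: "g \<in> harmonic N p" "h \<in> harmonic N p"
  proof
    assume "\<exists>c. \<forall>x\<in>K. g x - h x = c"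
    then show "sqn (\<lambda>j. g (p j) - h (p j)) = 0"
      unfolding form0_eq_0_iff using vertex_in_K by metis
  next
    assume 0: "sqn (\<lambda>j. g (p j) - h (p j)) = 0"
    have "g x - h x = g (p 0) - h (p 0)" if x: "x \<in> K" for x
    proof -
      have "g x - h x = hext (\<lambda>j. g (p j) - h (p j)) x"
        using harmonic_diff[OF gh] x unfolding harmonic_iff by blast
      also have "\<dots> = hext (\<lambda>_. g (p 0) - h (p 0)) x"
        by (intro hext_cong[OF x]) (use 0 N_pos in \<open>unfold form0_eq_0_iff, blast\<close>)
      finally show ?thesis
        by (simp add: hext_const x)
    qed
    then show "\<exists>c. \<forall>x\<in>K. g x - h x = c"
      by blast
  qed
  then show ?thesis
    by (auto simp: const_rel_def)
qed

lemma equiv_const_rel: "equiv (harmonic N p) (const_rel N p)"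
proof (rule equivI)
  show "sym (const_rel N p)"
    by (rule symI) (unfold const_rel_iff, subst sqn_diff_commute, blast)
  show "trans (const_rel N p)"
    by (rule transI) (auto simp: const_rel_iff intro: sqn_diff_trans)
qed (auto simp: refl_on_def const_rel_iff form0_eq_0_iff)

definition harm_class :: "(nat \<Rightarrow> real) \<Rightarrow> ('a \<Rightarrow> real) set" where
  "harm_class b = P_tilde N p (hext b)"

lemma P_tilde_eq_iff:
  assumes "g \<in> harmonic N p" "h \<in> harmonic N p"
  shows "P_tilde N p g = P_tilde N p h \<longleftrightarrow> sqn (\<lambda>j. g (p j) - h (p j)) = 0"
  unfolding P_tilde_def eq_equiv_class_iff[OF equiv_const_rel assms] const_rel_iff
  using assms by simp

lemma P_tilde_eq_harm_class:
  assumes "g \<in> harmonic N p" "sqn (\<lambda>j. g (p j) - b j) = 0"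
  shows "P_tilde N p g = harm_class b"
proof -
  have "sqn (\<lambda>j. g (p j) - hext b (p j)) = sqn (\<lambda>j. g (p j) - b j)"
    by (rule form0_cong) (auto simp: hext_vertex)
  then show ?thesis
    unfolding harm_class_def P_tilde_eq_iff[OF assms(1) hext_harmonic] using assms(2) by simp
qed

lemma harm_class_eq_iff: "harm_class b = harm_class c \<longleftrightarrow> sqn (\<lambda>j. b j - c j) = 0"
proof -
  have "sqn (\<lambda>j. hext b (p j) - hext c (p j)) = sqn (\<lambda>j. b j - c j)"
    by (rule form0_cong) (auto simp: hext_vertex)
  then show ?thesis
    unfolding harm_class_def P_tilde_eq_iff[OF hext_harmonic hext_harmonic] by simp
qed

lemma mem_harm_class: "h \<in> harm_class b \<longleftrightarrow> h \<in> harmonic N p \<and> sqn (\<lambda>j. h (p j) - b j) = 0"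
proof -
  have "sqn (\<lambda>j. hext b (p j) - h (p j)) = sqn (\<lambda>j. b j - h (p j))"
    by (rule form0_cong) (auto simp: hext_vertex)
  then show ?thesis
    by (simp add: harm_class_def P_tilde_def const_rel_iff hext_harmonic sqn_diff_commute[of b])
qed

lemma hext_in_harm_class: "hext b \<in> harm_class b"
proof -
  have "sqn (\<lambda>j. hext b (p j) - b j) = sqn (\<lambda>j. b j - b j)"
    by (rule form0_cong) (auto simp: hext_vertex)
  then show ?thesis
    by (simp add: mem_harm_class hext_harmonic form0_def)
qed

lemma Htilde_eq: "Htilde N p = range harm_class"
proof
  show "Htilde N p \<subseteq> range harm_class"
  proof
    fix X assume "X \<in> Htilde N p"
    then obtain g where "g \<in> harmonic N p" "X = P_tilde N p g"
      by (auto simp: Htilde_def P_tilde_def elim: quotientE)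
    then have "X = harm_class (\<lambda>j. g (p j))"
      using P_tilde_eq_harm_class[of g "\<lambda>j. g (p j)"] by (simp add: form0_def)
    then show "X \<in> range harm_class" by blast
  qed
  show "range harm_class \<subseteq> Htilde N p"
    by (auto simp: harm_class_def Htilde_def P_tilde_def intro: quotientI hext_harmonic)
qed

lemma diff_tilde_harm_class: "diff_tilde N p (harm_class b) (harm_class c) = harm_class (\<lambda>j. b j - c j)"
proof -
  have "P_tilde N p (\<lambda>x. g x - h x) = harm_class (\<lambda>j. b j - c j)" if g: "g \<in> harm_class b" and h: "h \<in> harm_class c" for g h
  proof (rule P_tilde_eq_harm_class)
    show "(\<lambda>x. g x - h x) \<in> harmonic N p"
      using g h by (intro harmonic_diff) (auto simp: mem_harm_class)
    show "sqn (\<lambda>j. g (p j) - h (p j) - (b j - c j)) = 0"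
      unfolding form0_eq_0_iff
    proof (intro allI impI)
      fix j k assume "j < N" "k < N"
      then have "g (p j) - b j = g (p k) - b k" "h (p j) - c j = h (p k) - c k"
        using g h unfolding mem_harm_class form0_eq_0_iff by blast+
      then show "g (p j) - h (p j) - (b j - c j) = g (p k) - h (p k) - (b k - c k)"
        by linarith
    qed
  qed
  then show ?thesis
    unfolding diff_tilde_def using hext_in_harm_class by blast
qed

lemma inner_tilde_harm_class: "inner_tilde N p (harm_class b) (harm_class b) = sqn b"
proof -
  define g where "g = (SOME g. g \<in> harm_class b)"
  have "g \<in> harm_class b"
    unfolding g_def by (rule someI[of _ "hext b"]) (rule hext_in_harm_class)
  then have g: "\<And>x. x \<in> K \<Longrightarrow> g x = hext (\<lambda>j. g (p j)) x" "sqn (\<lambda>j. g (p j) - b j) = 0"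
    unfolding mem_harm_class harmonic_iff by blast+
  have "energy_level N p m g g = sqn b" for m
  proof -
    have "energy_level N p m g g = energy_level N p m (hext (\<lambda>j. g (p j))) g"
      by (rule energy_level_cong[OF g(1) refl])
    then show ?thesis
      using sqn_cong_diff[OF g(2)] by (simp add: energy_level_hext)
  qed
  then show ?thesis
    by (simp add: inner_tilde_def energy_def g_def[symmetric])
qed

lemma dist_tilde_harm_class: "dist_tilde N p (harm_class b) (harm_class c) = sqrt (sqn (\<lambda>j. b j - c j))"
  by (simp add: dist_tilde_def diff_tilde_harm_class inner_tilde_harm_class)

lemma cell_ext_diff:
  "cell_ext N i (\<lambda>j. b j - c j) = (\<lambda>j. cell_ext N i b j - cell_ext N i c j)"
  using cell_ext_linear[of N i 1 b "-1" c] by simp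

lemma sqn_cell_ext_eq_0:
  assumes "i < N"
  shows "sqn (cell_ext N i b) = 0 \<longleftrightarrow> sqn b = 0"
proof
  assume "sqn b = 0"
  then show "sqn (cell_ext N i b) = 0"
    using form0_cell_ext_le[OF assms, of b] form0_nonneg[of N "cell_ext N i b"] by simp
next
  assume 0: "sqn (cell_ext N i b) = 0"
  have "sqn b \<le> 0"
    using form0_cell_ext_inv[OF assms, of "cell_ext N i b"] 0
    by (simp add: cell_ext_inv_cell_ext[OF assms])
  then show "sqn b = 0"
    using form0_nonneg[of N b] by simp
qed

lemma A_tilde_harm_class:
  assumes "i < N"
  shows "A_tilde N p i (harm_class b) = harm_class (cell_ext N i b)"
proof -
  have "P_tilde N p (h \<circ> F_map p i) = harm_class (cell_ext N i b)" if h: "h \<in> harm_class b" for h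
  proof (rule P_tilde_eq_harm_class)
    have hh: "h \<in> harmonic N p" "sqn (\<lambda>j. h (p j) - b j) = 0"
      using h by (auto simp: mem_harm_class)
    then show "h \<circ> F_map p i \<in> harmonic N p"
      by (intro harmonic_F_map assms)
    have "sqn (\<lambda>j. (h \<circ> F_map p i) (p j) - cell_ext N i b j) =
        sqn (\<lambda>j. cell_ext N i (\<lambda>j. h (p j)) j - cell_ext N i b j)"
      by (rule form0_cong) (auto simp: harmonic_F_map_vertex hh assms)
    also have "\<dots> = sqn (cell_ext N i (\<lambda>j. h (p j) - b j))"
      by (simp add: cell_ext_diff)
    also have "\<dots> = 0"
      using hh assms by (simp add: sqn_cell_ext_eq_0)
    finally show "sqn (\<lambda>j. (h \<circ> F_map p i) (p j) - cell_ext N i b j) = 0" .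
  qed
  then show ?thesis
    unfolding A_tilde_def using hext_in_harm_class by blast
qed

lemma inj_A_tilde:
  assumes "i < N"
  shows "inj_on (A_tilde N p i) (Htilde N p)"
proof (rule inj_onI)
  fix X Y assume "X \<in> Htilde N p" "Y \<in> Htilde N p" and eq: "A_tilde N p i X = A_tilde N p i Y"
  then obtain b c where X: "X = harm_class b" "Y = harm_class c"
    by (auto simp: Htilde_eq)
  have "sqn (cell_ext N i (\<lambda>j. b j - c j)) = 0"
    using eq unfolding X A_tilde_harm_class[OF assms] harm_class_eq_iff cell_ext_diff .
  then show "X = Y"
    unfolding X harm_class_eq_iff sqn_cell_ext_eq_0[OF assms] .
qed

text \<open>
  Injectivity is what gives \<open>inv_into\<close> in the definition of the gradient its meaning.
\<close>

lemma inj_A_tilde_word: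
  "w \<in> words N m \<Longrightarrow> inj_on (A_tilde_word N p w) (Htilde N p)"
proof (induction w arbitrary: m)
  case (Cons i w)
  then have i: "i < N" and w: "w \<in> words N (m - 1)"
    by (auto simp: Cons_in_words)
  have "A_tilde N p i ` Htilde N p \<subseteq> Htilde N p"
    using A_tilde_harm_class[OF i] by (auto simp: Htilde_eq)
  then have "inj_on (A_tilde_word N p w) (A_tilde N p i ` Htilde N p)"
    using Cons.IH[OF w] inj_on_subset by blast
  then show ?case
    unfolding A_tilde_word.simps by (intro comp_inj_on inj_A_tilde i)
qed simp


lemma A_tilde_word_harm_class:
  "w \<in> words N m \<Longrightarrow> A_tilde_word N p w (harm_class (word_ext_inv N w c)) = harm_class c"
  by (induction w arbitrary: m) (auto simp: Cons_in_words A_tilde_harm_class cell_ext_cell_ext_inv)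

lemma H_tilde_eq: "H_tilde N p f = harm_class (\<lambda>j. f (p j))"
proof -
  have "H_ext N p f \<in> harmonic N p \<and> (\<forall>x\<in>V0 N p. H_ext N p f x = f x)"
    unfolding H_ext_def
    by (rule someI[of _ "hext (\<lambda>j. f (p j))"]) (auto simp: hext_harmonic V0_def hext_vertex)
  then have H: "H_ext N p f \<in> harmonic N p" "\<And>j. j < N \<Longrightarrow> H_ext N p f (p j) = f (p j)"
    by (auto simp: V0_def)
  have "sqn (\<lambda>j. H_ext N p f (p j) - f (p j)) = sqn (\<lambda>_. 0)"
    by (rule form0_cong) (auto simp: H)
  then show ?thesis
    unfolding H_tilde_def by (intro P_tilde_eq_harm_class H) (simp add: form0_def)
qed

lemma prefix_in_words: "(\<And>k. \<omega> k < N) \<Longrightarrow> map \<omega> [0..<n] \<in> words N n"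
  by (auto simp: words_def)

lemma grad_n_eq:
  assumes "\<And>k. \<omega> k < N"
  shows "grad_n N p n f \<omega> = harm_class (word_ext_inv N (map \<omega> [0..<n]) (cell_vals f (map \<omega> [0..<n])))"
  unfolding grad_n_def H_tilde_eq
proof (rule inv_into_f_eq)
  show "inj_on (A_tilde_word N p (map \<omega> [0..<n])) (Htilde N p)"
    by (rule inj_A_tilde_word[OF prefix_in_words[OF assms]])
  show "A_tilde_word N p (map \<omega> [0..<n])
      (harm_class (word_ext_inv N (map \<omega> [0..<n]) (cell_vals f (map \<omega> [0..<n])))) =
      harm_class (\<lambda>j. (f \<circ> F_word p (map \<omega> [0..<n])) (p j))"
    by (simp add: A_tilde_word_harm_class[OF prefix_in_words[OF assms]])
qed (simp add: Htilde_eq)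

text \<open>
  Summable increments make the representatives normalised to vanish at \<open>p 0\<close> converge in each
  coordinate, hence the classes converge in norm.
\<close>

lemma gradient_defined_if_summable:
  assumes \<omega>: "\<And>k. \<omega> k < N"
    and grad: "\<And>n. grad_n N p n f \<omega> = harm_class (b n)"
    and summable: "summable (\<lambda>n. sqrt (sqn (\<lambda>j. b (Suc n) j - b n j)))"
  shows "gradient_defined N p f \<omega>"
proof -
  define x where "x n j = b n j - b n 0" for n j
  have "convergent (\<lambda>n. x n j)" if "j < N" for j
  proof -
    have "norm (x (Suc n) j - x n j) \<le> sqrt (sqn (\<lambda>j. b (Suc n) j - b n j))" for n
      using abs_diff_le_form0[OF that N_pos(1), of "\<lambda>j. b (Suc n) j - b n j"]
      by (simp add: x_def algebra_simps)
    then have "summable (\<lambda>n. x (Suc n) j - x n j)"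
      by (intro summable_comparison_test[OF _ summable]) blast
    then have "convergent (\<lambda>n. x n j - x 0 j)"
      unfolding summable_iff_convergent sum_lessThan_telescope[of "\<lambda>n. x n j"] .
    then have "convergent (\<lambda>n. (x n j - x 0 j) + x 0 j)"
      by (intro convergent_add convergent_const)
    then show ?thesis
      by simp
  qed
  then obtain L where L: "\<And>j. j < N \<Longrightarrow> (\<lambda>n. x n j) \<longlonglongrightarrow> L j"
    unfolding convergent_def by metis
  have "(\<lambda>n. sqrt (sqn (\<lambda>j. x n j - L j))) \<longlonglongrightarrow> sqrt (sqn (\<lambda>j. L j - L j))"
    unfolding form0_def by (intro tendsto_intros L) auto
  moreover have "sqn (\<lambda>j. x n j - L j) = sqn (\<lambda>j. b n j - L j)" for n
    by (rule sqn_cong_diff) (simp add: form0_def x_def)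
  ultimately have "(\<lambda>n. dist_tilde N p (grad_n N p n f \<omega>) (harm_class L)) \<longlonglongrightarrow> 0"
    by (simp add: grad dist_tilde_harm_class form0_def)
  then show ?thesis
    unfolding gradient_defined_def has_gradient_def Htilde_eq by blast
qed


section \<open>Test functions supported in a cell\<close>

lemma abs_cell_ext_le:
  assumes "i < N" "j < N" "\<And>j. j < N \<Longrightarrow> \<bar>b j\<bar> \<le> B"
  shows "\<bar>cell_ext N i b j\<bar> \<le> B"
proof (cases "j = i")
  case False
  have "\<bar>b i + b j + (\<Sum>k<N. b k)\<bar> \<le> \<bar>b i\<bar> + \<bar>b j\<bar> + (\<Sum>k<N. \<bar>b k\<bar>)"
    using sum_abs[of b "{..<N}"] by linarith
  also have "\<dots> \<le> B + B + (\<Sum>k<N. B)"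
    using assms by (intro add_mono sum_mono) auto
  also have "\<dots> = B * (real N + 2)"
    by (simp add: algebra_simps)
  finally show ?thesis
    using False N_pos by (simp add: cell_ext_def divide_le_eq)
qed (use assms in simp)

lemma abs_hext_le:
  assumes "\<And>j. j < N \<Longrightarrow> \<bar>b j\<bar> \<le> B" "x \<in> K"
  shows "\<bar>hext b x\<bar> \<le> B"
proof -
  have "\<bar>approx m b x\<bar> \<le> B" for m
    using assms
  proof (induction m arbitrary: b x)
    case 0
    then show ?case
      using convex_bound[of x b 0 B] by simp
  next
    case (Suc m)
    from K_cases[OF Suc.prems(2)] obtain i y where iy: "i < N" "y \<in> K" "x = F_map p i y" .
    show ?case
      unfolding iy(3) approx_F_map[OF iy(1,2)]
      using Suc.prems(1) iy by (intro Suc.IH abs_cell_ext_le) auto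
  qed
  then show ?thesis
    using tendsto_rabs[OF approx_tendsto[OF assms(2), of b]] by (intro LIMSEQ_le_const2) auto
qed

text \<open>
  Transplantation of \<open>\<phi>\<close> to the cell \<open>w\<close>, extended by zero. It is continuous when \<open>\<phi>\<close> vanishes on the
  boundary.
\<close>

primrec lift_cell :: "nat list \<Rightarrow> ('a \<Rightarrow> real) \<Rightarrow> 'a \<Rightarrow> real" where
  "lift_cell [] \<phi> = \<phi>"
| "lift_cell (k # w) \<phi> = glue (\<lambda>i. if i = k then lift_cell w \<phi> else (\<lambda>_. 0))"

lemma lift_cell_vertex:
  assumes "\<And>j. j < N \<Longrightarrow> \<phi> (p j) = 0" "j < N"
  shows "lift_cell w \<phi> (p j) = 0"
  using assms(2)
proof (induction w arbitrary: j)
  case (Cons k w)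
  have "lift_cell (k # w) \<phi> (F_map p j (p j)) = (if j = k then lift_cell w \<phi> else (\<lambda>_. 0)) (p j)"
    unfolding lift_cell.simps
    by (rule glue_F_map) (use Cons vertex_in_K in auto)
  then show ?case
    using Cons by simp
qed (use assms in simp)

lemma lift_cell_F_map:
  assumes "\<And>j. j < N \<Longrightarrow> \<phi> (p j) = 0" "i < N" "x \<in> K"
  shows "lift_cell (k # w) \<phi> (F_map p i x) = (if i = k then lift_cell w \<phi> x else 0)"
  using glue_F_map[of "\<lambda>i. if i = k then lift_cell w \<phi> else (\<lambda>_. 0)" i x] assms lift_cell_vertex[of \<phi>]
  by auto

lemma continuous_on_lift_cell:
  assumes "\<And>j. j < N \<Longrightarrow> \<phi> (p j) = 0" "continuous_on K \<phi>"
  shows "continuous_on K (lift_cell w \<phi>)"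
proof (induction w)
  case (Cons k w)
  show ?case
    unfolding lift_cell.simps
    by (rule continuous_on_glue) (use Cons lift_cell_vertex[of \<phi>] assms in auto)
qed (use assms in simp)

lemma abs_lift_cell_le:
  assumes "\<And>j. j < N \<Longrightarrow> \<phi> (p j) = 0" "\<And>x. x \<in> K \<Longrightarrow> \<bar>\<phi> x\<bar> \<le> B" "x \<in> K"
  shows "\<bar>lift_cell w \<phi> x\<bar> \<le> B"
  using assms(3)
proof (induction w arbitrary: x)
  case (Cons k w)
  from K_cases[OF Cons.prems] obtain i y where iy: "i < N" "y \<in> K" "x = F_map p i y" .
  have "0 \<le> B"
    using assms(2)[OF assms(3)] by linarith
  then show ?case
    using Cons.IH[OF iy(2)]
    by (simp add: iy(3) lift_cell_F_map[of \<phi>, OF assms(1) iy(1,2)] del: lift_cell.simps)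
qed (use assms in simp)

lemma energy_level_zero_right:
  assumes "\<And>x. x \<in> K \<Longrightarrow> v x = 0"
  shows "energy_level N p m u v = 0"
proof -
  have "energy_level N p m u v = energy_level N p m u (\<lambda>_. 0)"
    by (rule energy_level_cong) (auto simp: assms)
  then show ?thesis
    by (simp add: energy_level_eq form0_def)
qed

lemma energy_level_lift_cell:
  assumes "\<And>j. j < N \<Longrightarrow> \<phi> (p j) = 0" "w \<in> words N n"
  shows "energy_level N p (n + m) u (lift_cell w \<phi>) =
    ((real N + 2) / real N) ^ n * energy_level N p m (u \<circ> F_word p w) \<phi>"
  using assms(2)
proof (induction n arbitrary: w u)
  case (Suc n)
  from Suc.prems obtain k w' where w: "w = k # w'" "k < N" "w' \<in> words N n"
    by (auto simp: words_Suc)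
  have "energy_level N p (n + m) (u \<circ> F_map p i) (lift_cell w \<phi> \<circ> F_map p i) =
      (if i = k then energy_level N p (n + m) (u \<circ> F_map p k) (lift_cell w' \<phi>) else 0)" if "i < N" for i
  proof (cases "i = k")
    case True
    then show ?thesis
      unfolding w(1)
      by (auto intro!: energy_level_cong simp: lift_cell_F_map[of \<phi>, OF assms(1) w(2)] simp del: lift_cell.simps)
  next
    case False
    then show ?thesis
      unfolding w(1)
      by (auto intro!: energy_level_zero_right simp: lift_cell_F_map[of \<phi>, OF assms(1) that] simp del: lift_cell.simps)
  qed
  then have "energy_level N p (Suc n + m) u (lift_cell w \<phi>) =
      (real N + 2) / real N * energy_level N p (n + m) (u \<circ> F_map p k) (lift_cell w' \<phi>)"
    using w(2) by (simp add: energy_level_Suc)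
  also have "\<dots> = ((real N + 2) / real N) ^ Suc n * energy_level N p m (u \<circ> F_word p w) \<phi>"
    unfolding Suc.IH[OF w(3)] by (simp add: w(1) comp_assoc)
  finally show ?case .
qed simp

text \<open>
  Piecewise harmonic functions of level one. The pieces fit together when \<open>c\<close> is symmetric, and the
  function vanishes on the boundary when the diagonal of \<open>c\<close> is zero. From level one on their energies
  are constant, so transplants of them have explicit energies against every function.
\<close>

definition spline :: "(nat \<Rightarrow> nat \<Rightarrow> real) \<Rightarrow> 'a \<Rightarrow> real" where
  "spline c = glue (\<lambda>i. hext (c i))"

context
  fixes c :: "nat \<Rightarrow> nat \<Rightarrow> real"
  assumes c_sym: "\<And>i j. i < N \<Longrightarrow> j < N \<Longrightarrow> c i j = c j i"
    and c_diag: "\<And>i. i < N \<Longrightarrow> c i i = 0"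
begin

lemma spline_F_map:
  assumes "i < N" "x \<in> K"
  shows "spline c (F_map p i x) = hext (c i) x"
  unfolding spline_def by (rule glue_F_map) (use assms c_sym in \<open>auto simp: hext_vertex\<close>)

lemma continuous_on_spline: "continuous_on K (spline c)"
  unfolding spline_def
  by (rule continuous_on_glue) (use c_sym in \<open>auto simp: hext_vertex continuous_on_hext\<close>)

lemma spline_vertex: "j < N \<Longrightarrow> spline c (p j) = 0"
  using spline_F_map[of j "p j"] by (simp add: vertex_in_K hext_vertex c_diag)

lemma energy_level_spline:
  "energy_level N p (Suc m) v (spline c) =
    (real N + 2) / real N * (\<Sum>i<N. form0 N (\<lambda>j. v (F_map p i (p j))) (c i))"
proof -
  have "energy_level N p m (v \<circ> F_map p i) (spline c \<circ> F_map p i) =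
      form0 N (\<lambda>j. v (F_map p i (p j))) (c i)" if "i < N" for i
  proof -
    have "energy_level N p m (v \<circ> F_map p i) (spline c \<circ> F_map p i) =
        energy_level N p m (v \<circ> F_map p i) (hext (c i))"
      by (rule energy_level_cong) (auto simp: spline_F_map that)
    also have "\<dots> = form0 N (c i) (\<lambda>j. v (F_map p i (p j)))"
      unfolding energy_level_commute[of m _ "hext (c i)"] energy_level_hext by simp
    finally show ?thesis
      by (simp only: form0_commute)
  qed
  then show ?thesis
    by (simp add: energy_level_Suc)
qed

lemma energy_level_lift_spline:
  assumes "w \<in> words N n"
  shows "energy_level N p (m + Suc n) u (lift_cell w (spline c)) =
    ((real N + 2) / real N) ^ Suc n * (\<Sum>i<N. form0 N (cell_vals u (w @ [i])) (c i))"
proof -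
  have eq: "m + Suc n = n + Suc m"
    by simp
  have "energy_level N p (n + Suc m) u (lift_cell w (spline c)) =
      ((real N + 2) / real N) ^ n * energy_level N p (Suc m) (u \<circ> F_word p w) (spline c)"
    using assms by (intro energy_level_lift_cell spline_vertex)
  then show ?thesis
    unfolding eq energy_level_spline by (simp add: F_word_append)
qed

lemma energy_lift_spline:
  assumes "w \<in> words N n"
  shows "energy N p u (lift_cell w (spline c)) =
    ((real N + 2) / real N) ^ Suc n * (\<Sum>i<N. form0 N (cell_vals u (w @ [i])) (c i))"
  unfolding energy_def
proof (rule limI, rule LIMSEQ_offset)
  show "(\<lambda>m. energy_level N p (m + Suc n) u (lift_cell w (spline c))) \<longlonglongrightarrow>
      ((real N + 2) / real N) ^ Suc n * (\<Sum>i<N. form0 N (cell_vals u (w @ [i])) (c i))"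
    unfolding energy_level_lift_spline[OF assms] by (rule tendsto_const)
qed

lemma lift_spline_dom0:
  assumes "w \<in> words N n"
  shows "lift_cell w (spline c) \<in> dom0_energy N p"
proof -
  have "convergent (\<lambda>m. energy_level N p m (lift_cell w (spline c)) (lift_cell w (spline c)))"
  proof (rule convergentI, rule LIMSEQ_offset)
    show "(\<lambda>m. energy_level N p (m + Suc n) (lift_cell w (spline c)) (lift_cell w (spline c)))
       \<longlonglongrightarrow> ((real N + 2) / real N) ^ Suc n *
          (\<Sum>i<N. form0 N (cell_vals (lift_cell w (spline c)) (w @ [i])) (c i))"
      unfolding energy_level_lift_spline[OF assms] by (rule tendsto_const)
  qed
  moreover have "lift_cell w (spline c) x = 0" if "x \<in> V0 N p" for x
    using that lift_cell_vertex[of "spline c", OF spline_vertex] by (auto simp: V0_def)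
  ultimately show ?thesis
    by (simp add: dom0_energy_def dom_energy_def continuous_on_lift_cell spline_vertex continuous_on_spline)
qed

lemma abs_spline_le:
  assumes "\<And>i j. i < N \<Longrightarrow> j < N \<Longrightarrow> \<bar>c i j\<bar> \<le> B" "x \<in> K"
  shows "\<bar>spline c x\<bar> \<le> B"
proof -
  from K_cases[OF assms(2)] obtain i y where "i < N" "y \<in> K" "x = F_map p i y" .
  then show ?thesis
    using assms(1) by (simp add: spline_F_map abs_hext_le)
qed

end

section \<open>Decay of the Laplacian on small cells\<close>

lemma measurable_on_gasket:
  fixes g :: "'a \<Rightarrow> real"
  assumes "standard_bernoulli N p \<mu>" "continuous_on K g"
  shows "g \<in> borel_measurable \<mu>" and "space \<mu> = K"
proof -
  have "sets \<mu> = sets (restrict_space borel K)"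
    using assms(1) by (simp add: standard_bernoulli_def)
  then show "g \<in> borel_measurable \<mu>" "space \<mu> = K"
    using borel_measurable_continuous_on_restrict[OF assms(2)]
    by (simp_all cong: measurable_cong_sets add: sets_eq_imp_space_eq[of \<mu>] space_restrict_space)
qed

text \<open>
  Self-similarity of the measure is applied to the set where the transplant is non-zero rather than
  to the cell: its preimages under all maps but one are empty, since the points shared with other
  cells do not belong to it.
\<close>

lemma measure_support_lift_cell:
  assumes \<mu>: "standard_bernoulli N p \<mu>" and "\<And>j. j < N \<Longrightarrow> \<phi> (p j) = 0" "continuous_on K \<phi>"
    and "w \<in> words N n"
  shows "measure \<mu> {x \<in> K. lift_cell w \<phi> x \<noteq> 0} \<le> 1 / real N ^ n"
  using assms(4)
proof (induction n arbitrary: w)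
  case 0
  then show ?case
    using \<mu> by (simp add: standard_bernoulli_def prob_space.prob_le_1)
next
  case (Suc n)
  from Suc.prems obtain k w' where w: "w = k # w'" "k < N" "w' \<in> words N n"
    by (auto simp: words_Suc)
  let ?A = "{x \<in> K. lift_cell w \<phi> x \<noteq> 0}"
  have "lift_cell w \<phi> \<in> borel_measurable \<mu>" "space \<mu> = K"
    using measurable_on_gasket[OF \<mu> continuous_on_lift_cell[of \<phi>, OF assms(2,3)]] by blast+
  then have "{x \<in> space \<mu>. lift_cell w \<phi> x \<noteq> 0} \<in> sets \<mu>"
    by measurable
  then have A: "?A \<in> sets \<mu>"
    using \<open>space \<mu> = K\<close> by simp
  have "F_map p i -` ?A \<inter> K = (if i = k then {x \<in> K. lift_cell w' \<phi> x \<noteq> 0} else {})" if "i < N" for i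
    using that w F_map_in_K lift_cell_F_map[of \<phi>, OF assms(2) that]
    by (auto simp del: lift_cell.simps)
  then have "(\<Sum>i<N. measure \<mu> (F_map p i -` ?A \<inter> K)) =
      (\<Sum>i<N. if i = k then measure \<mu> {x \<in> K. lift_cell w' \<phi> x \<noteq> 0} else 0)"
    by (intro sum.cong) auto
  then have "(\<Sum>i<N. measure \<mu> (F_map p i -` ?A \<inter> K)) = measure \<mu> {x \<in> K. lift_cell w' \<phi> x \<noteq> 0}"
    using w(2) by simp
  then have "measure \<mu> ?A = 1 / real N * measure \<mu> {x \<in> K. lift_cell w' \<phi> x \<noteq> 0}"
    using \<mu> A by (simp add: standard_bernoulli_def)
  also have "\<dots> \<le> 1 / real N * (1 / real N ^ n)"
    by (intro mult_left_mono Suc.IH w) simp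
  finally show ?case
    by simp
qed

lemma abs_integral_lift_cell_le:
  assumes \<mu>: "standard_bernoulli N p \<mu>" and \<phi>: "\<And>j. j < N \<Longrightarrow> \<phi> (p j) = 0" "continuous_on K \<phi>"
    "\<And>x. x \<in> K \<Longrightarrow> \<bar>\<phi> x\<bar> \<le> 1"
    and f: "continuous_on K f" "\<And>x. x \<in> K \<Longrightarrow> \<bar>f x\<bar> \<le> M"
    and w: "w \<in> words N n"
  shows "\<bar>LINT x|\<mu>. f x * lift_cell w \<phi> x\<bar> \<le> M / real N ^ n"
proof -
  interpret prob_space \<mu>
    using \<mu> by (simp add: standard_bernoulli_def)
  let ?\<psi> = "lift_cell w \<phi>"
  define A where "A = {x \<in> space \<mu>. ?\<psi> x \<noteq> 0}"
  have sp: "space \<mu> = K" and mf: "f \<in> borel_measurable \<mu>"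
    using measurable_on_gasket[OF \<mu> f(1)] by blast+
  have m\<psi>: "?\<psi> \<in> borel_measurable \<mu>"
    using measurable_on_gasket[OF \<mu> continuous_on_lift_cell[of \<phi>, OF \<phi>(1,2)]] by blast
  have A: "A \<in> sets \<mu>"
    unfolding A_def using m\<psi> by measurable
  have M: "M \<ge> 0"
    using f(2) gasket_K(1) by force
  have pt: "\<bar>f x * ?\<psi> x\<bar> \<le> M * indicator A x" if x: "x \<in> space \<mu>" for x
  proof (cases "?\<psi> x = 0")
    case False
    have "\<bar>f x\<bar> * \<bar>?\<psi> x\<bar> \<le> M * 1"
      using x M unfolding sp
      by (intro mult_mono f abs_lift_cell_le[of \<phi>] \<phi>) auto
    then show ?thesis
      using False x by (simp add: A_def abs_mult)
  qed (use M in simp)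
  have "integrable \<mu> (\<lambda>x. f x * ?\<psi> x)"
  proof (rule integrable_const_bound[of _ M])
    show "AE x in \<mu>. norm (f x * ?\<psi> x) \<le> M"
    proof (rule AE_I2)
      fix x assume "x \<in> space \<mu>"
      from pt[OF this] show "norm (f x * ?\<psi> x) \<le> M"
        using M by (cases "x \<in> A") auto
    qed
  qed (use mf m\<psi> in measurable)
  then have "integrable \<mu> (\<lambda>x. \<bar>f x * ?\<psi> x\<bar>)"
    by (rule integrable_abs)
  moreover have "integrable \<mu> (\<lambda>x. M * indicator A x)"
    using A by (intro integrable_mult_right integrable_real_indicator) (auto simp: emeasure_eq_measure)
  ultimately have "(LINT x|\<mu>. \<bar>f x * ?\<psi> x\<bar>) \<le> (LINT x|\<mu>. M * indicator A x)"
    using pt by (rule integral_mono)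
  also have "\<dots> = M * measure \<mu> A"
    using A by simp
  also have "\<dots> \<le> M * (1 / real N ^ n)"
    using measure_support_lift_cell[OF \<mu> \<phi>(1,2) w] M
    by (intro mult_left_mono) (simp_all add: A_def sp)
  finally have "(LINT x|\<mu>. \<bar>f x * ?\<psi> x\<bar>) \<le> M / real N ^ n"
    by simp
  then show ?thesis
    by (rule order_trans[OF integral_abs_bound])
qed


text \<open>
  Up to the renormalisation, the energy of level one against the indicator function of the midpoint
  of \<open>p a\<close> and \<open>p b\<close> is the graph Laplacian at this point.
\<close>

lemma edge_test_form0:
  fixes D :: "nat \<Rightarrow> nat \<Rightarrow> real"
  assumes "a < N" "b < N"
  shows "(\<Sum>i<N. form0 N (D i) (\<lambda>j. (if i = a \<and> j = b then 1 else 0) + (if i = b \<and> j = a then 1 else 0)))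
    = (real N * D a b - (\<Sum>k<N. D a k)) + (real N * D b a - (\<Sum>k<N. D b k))"
proof -
  have "form0 N (D i) (\<lambda>j. (if i = a \<and> j = b then 1 else 0) + (if i = b \<and> j = a then 1 else 0)) =
      (if i = a then real N * D i b - (\<Sum>k<N. D i k) else 0) +
      (if i = b then real N * D i a - (\<Sum>k<N. D i k) else 0)" for i
  proof -
    let ?g = "\<lambda>j. real N * D i j - (\<Sum>k<N. D i k)"
    have "(\<Sum>j<N. ?g j * ((if i = a \<and> j = b then 1 else 0) + (if i = b \<and> j = a then 1 else 0))) =
        (\<Sum>j<N. (if j = b then if i = a then ?g j else 0 else 0) +
          (if j = a then if i = b then ?g j else 0 else 0))"
      by (intro sum.cong) auto
    then show ?thesis
      using assms unfolding form0_eq_sum by (simp add: sum.distrib)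
  qed
  then show ?thesis
    using assms by (simp add: sum.distrib)
qed

text \<open>
  The weak equation is tested with the transplanted indicator of a midpoint. The left side carries the
  renormalisation \<open>((N + 2) / N) ^ (n + 1)\<close>, the right side at most the measure \<open>1 / N ^ n\<close> of the cell,
  so the graph Laplacian of \<open>u\<close> at the midpoints is at most \<open>M / (N + 2) ^ n\<close>. The harmonic
  extension has Laplacian zero there, and the maximum principle turns the bound for the Laplacian
  of the difference into one for the difference.
\<close>

lemma harmonic_defect_le:
  assumes \<mu>: "standard_bernoulli N p \<mu>" and lap: "has_laplacian N p \<mu> u f"
    and M: "\<And>x. x \<in> K \<Longrightarrow> \<bar>f x\<bar> \<le> M"
    and w: "w \<in> words N n" and "i < N" "j < N"
  shows "\<bar>cell_vals u (w @ [i]) j - cell_ext N i (cell_vals u w) j\<bar> \<le> M / (real N + 2) ^ n"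
proof -
  define D where "D i j = cell_vals u (w @ [i]) j - cell_ext N i (cell_vals u w) j" for i j
  have M0: "M \<ge> 0"
    using M gasket_K(1) by force
  have sym: "D i j = D j i" for i j
    by (simp add: D_def F_word_append F_map_vertex_sym[of p i j] cell_ext_sym[of N i _ j])
  have "\<bar>D i j\<bar> \<le> M / (real N + 2) ^ n"
  proof (rule discrete_maximum_principle[of N])
    show "D i i = 0" for i
      by (simp add: D_def F_word_append)
    fix a b assume ab: "a < N" "b < N" "a \<noteq> b"
    define c where "c i j = (if i = a \<and> j = b then 1 else 0) + (if i = b \<and> j = a then 1 else (0::real))" for i j
    have c_sym: "c i j = c j i" and c_diag: "c i i = 0" and c_le: "\<bar>c i j\<bar> \<le> 1" for i j
      using ab by (auto simp: c_def)
    have "2 * real N * D a b - (\<Sum>k<N. D a k) - (\<Sum>k<N. D b k) = (\<Sum>i<N. form0 N (D i) (c i))"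
      using edge_test_form0[OF ab(1,2), of D] sym[of b a] unfolding c_def[symmetric] by simp
    also have "\<dots> = (\<Sum>i<N. form0 N (cell_vals u (w @ [i])) (c i))
        - (\<Sum>i<N. form0 N (cell_ext N i (cell_vals u w)) (c i))"
      unfolding sum_subtractf[symmetric]
      by (intro sum.cong refl) (simp add: D_def[abs_def] form0_diff_left)
    also have "(\<Sum>i<N. form0 N (cell_ext N i (cell_vals u w)) (c i)) = 0"
      using cell_ext_harmonic[of N c "cell_vals u w", OF N_pos(1) c_sym] N_pos
      by (simp add: c_diag form0_def)
    finally have E: "2 * real N * D a b - (\<Sum>k<N. D a k) - (\<Sum>k<N. D b k) =
        (\<Sum>i<N. form0 N (cell_vals u (w @ [i])) (c i))" by simp
    let ?\<psi> = "lift_cell w (spline c)"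
    have "energy N p u ?\<psi> = - (LINT x|\<mu>. f x * ?\<psi> x)"
      using lap lift_spline_dom0[of c, OF c_sym c_diag w] by (simp add: has_laplacian_def)
    moreover have "\<bar>LINT x|\<mu>. f x * ?\<psi> x\<bar> \<le> M / real N ^ n"
      using lap M
      by (intro abs_integral_lift_cell_le[OF \<mu> _ _ _ _ _ w] spline_vertex continuous_on_spline
          abs_spline_le c_sym c_diag c_le) (auto simp: has_laplacian_def)
    ultimately have "\<bar>((real N + 2) / real N) ^ Suc n * (\<Sum>i<N. form0 N (cell_vals u (w @ [i])) (c i))\<bar>
        \<le> M / real N ^ n"
      unfolding energy_lift_spline[of c, OF c_sym c_diag w] by simp
    then have *: "((real N + 2) / real N) ^ Suc n * \<bar>\<Sum>i<N. form0 N (cell_vals u (w @ [i])) (c i)\<bar>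
        \<le> M / real N ^ n"
      by (simp add: abs_mult)
    have "((real N + 2) / real N) ^ n * \<bar>\<Sum>i<N. form0 N (cell_vals u (w @ [i])) (c i)\<bar> \<le> M / real N ^ n"
    proof (rule order_trans[OF _ *], rule mult_right_mono)
      show "((real N + 2) / real N) ^ n \<le> ((real N + 2) / real N) ^ Suc n"
        using N_pos by (intro power_increasing) auto
    qed simp
    then have "(real N + 2) ^ n * \<bar>\<Sum>i<N. form0 N (cell_vals u (w @ [i])) (c i)\<bar> \<le> M"
      using N_pos by (simp add: power_divide divide_le_cancel)
    then show "\<bar>2 * real N * D a b - (\<Sum>k<N. D a k) - (\<Sum>k<N. D b k)\<bar> \<le> M / (real N + 2) ^ n"
      unfolding E by (subst pos_le_divide_eq) (simp_all add: mult.commute)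
  qed (use assms N_pos M0 in auto)
  then show ?thesis
    by (simp add: D_def)
qed

end

section \<open>Random products of inverse extension matrices\<close>

lemma word_ext_inv_cong:
  assumes "w \<in> words N n" "\<And>j. j < N \<Longrightarrow> b j = c j" "j < N"
  shows "word_ext_inv N w b j = word_ext_inv N w c j"
  using assms(1,3)
proof (induction w arbitrary: n j)
  case (Cons i w)
  then have "i < N" and IH: "\<And>j. j < N \<Longrightarrow> word_ext_inv N w b j = word_ext_inv N w c j"
    by (auto simp: Cons_in_words)
  then have "(\<Sum>k<N. word_ext_inv N w b k) = (\<Sum>k<N. word_ext_inv N w c k)"
    by simp
  with \<open>i < N\<close> Cons.prems(2) show ?case
    by (simp add: cell_ext_inv_def IH)
qed (use assms in simp)

text \<open>
  The square of the Hilbert-Schmidt norm of the inverse extension along a word.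
\<close>

definition growth :: "nat \<Rightarrow> nat list \<Rightarrow> real" where
  "growth N w = (\<Sum>k<N. form0 N (word_ext_inv N w (\<lambda>j. of_bool (j = k))) (word_ext_inv N w (\<lambda>j. of_bool (j = k))))"

lemma growth_nonneg: "growth N w \<ge> 0"
  unfolding growth_def by (intro sum_nonneg form0_nonneg)

lemma form0_word_ext_inv_le:
  assumes "w \<in> words N n" "\<And>j. j < N \<Longrightarrow> \<bar>d j\<bar> \<le> B"
  shows "form0 N (word_ext_inv N w d) (word_ext_inv N w d) \<le> real N * B\<^sup>2 * growth N w"
proof -
  let ?e = "\<lambda>k j. of_bool (j = k) :: real"
  have eq: "word_ext_inv N w d j = (\<Sum>k<N. d k * word_ext_inv N w (?e k) j)" if "j < N" for j
  proof -
    have "word_ext_inv N w d j = word_ext_inv N w (\<lambda>j. \<Sum>k<N. d k * ?e k j) j"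
      by (rule word_ext_inv_cong[OF assms(1) _ that]) (simp add: of_bool_def if_distrib cong: if_cong)
    then show ?thesis
      by (simp only: word_ext_inv_sum)
  qed
  have "form0 N (word_ext_inv N w d) (word_ext_inv N w d) =
      form0 N (\<lambda>j. \<Sum>k<N. d k * word_ext_inv N w (?e k) j) (\<lambda>j. \<Sum>k<N. d k * word_ext_inv N w (?e k) j)"
    by (rule form0_cong) (auto simp: eq)
  also have "\<dots> \<le> (\<Sum>k<N. (d k)\<^sup>2) * growth N w"
    unfolding growth_def by (rule form0_sum_le) simp
  also have "\<dots> \<le> (\<Sum>k<N. B\<^sup>2) * growth N w"
  proof (intro mult_right_mono sum_mono growth_nonneg)
    fix k assume "k \<in> {..<N}"
    then have "\<bar>d k\<bar> \<le> \<bar>B\<bar>"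
      using assms(2)[of k] by simp
    then show "(d k)\<^sup>2 \<le> B\<^sup>2"
      by (simp add: abs_le_square_iff)
  qed
  finally show ?thesis
    by simp
qed

text \<open>
  A letter put in front of the word acts on each column of the matrix from the left, so the average
  contraction applies columnwise. This gives the expected square norm exactly, by induction.
\<close>

lemma sum_growth:
  assumes "N > 0"
  shows "(\<Sum>w\<in>words N n. growth N w) =
    ((real N + 2)\<^sup>2 * ((real N)\<^sup>2 - real N - 1) / real N) ^ n * growth N []"
proof (induction n)
  case (Suc n)
  let ?q = "(real N + 2)\<^sup>2 * ((real N)\<^sup>2 - real N - 1) / real N"
  have "(\<Sum>w\<in>words N (Suc n). growth N w) = (\<Sum>w\<in>words N n. \<Sum>i<N. growth N (i # w))"
    unfolding sum_words_Suc by (rule sum.swap)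
  also have "(\<Sum>i<N. growth N (i # w)) = ?q * growth N w" for w
  proof -
    have "(\<Sum>i<N. growth N (i # w)) = (\<Sum>k<N. \<Sum>i<N.
        form0 N (word_ext_inv N (i # w) (\<lambda>j. of_bool (j = k))) (word_ext_inv N (i # w) (\<lambda>j. of_bool (j = k))))"
      unfolding growth_def by (rule sum.swap)
    then show ?thesis
      unfolding word_ext_inv.simps sum_form0_cell_ext_inv[OF assms] growth_def
      by (simp only: sum_distrib_left)
  qed
  then have "(\<Sum>w\<in>words N n. \<Sum>i<N. growth N (i # w)) = (\<Sum>w\<in>words N n. ?q * growth N w)"
    by simp
  also have "\<dots> = ?q * (\<Sum>w\<in>words N n. growth N w)"
    by (simp only: sum_distrib_left)
  finally show ?case
    unfolding Suc.IH by (simp only: power_Suc mult.assoc)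
qed simp

section \<open>Almost sure summability along random words\<close>

lemma space_word_measure: "space (word_measure N) = (UNIV \<rightarrow>\<^sub>E {..<N})"
  by (simp add: word_measure_def space_PiM space_uniform_count_measure)

lemma cylinder_word_measure:
  assumes "N > 0" "w \<in> words N n"
  defines "C \<equiv> {\<omega> \<in> space (word_measure N). map \<omega> [0..<n] = w}"
  shows "C \<in> sets (word_measure N)" "emeasure (word_measure N) C = ennreal (1 / real N ^ n)"
proof -
  interpret product_prob_space "\<lambda>_::nat. uniform_count_measure {..<N}" UNIV
    using assms(1) by (intro product_prob_spaceI prob_space_uniform_count_measure) auto
  have len: "length w = n" and lt: "\<And>i. i < n \<Longrightarrow> w ! i < N"
    using assms(2) by (auto simp: words_def dest: nth_mem)
  have C: "C = prod_emb UNIV (\<lambda>_. uniform_count_measure {..<N}) {..<n} (Pi\<^sub>E {..<n} (\<lambda>i. {w ! i}))"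
    unfolding C_def space_word_measure
    by (auto simp: prod_emb_def space_uniform_count_measure list_eq_iff_nth_eq len PiE_iff extensional_def)
  show "C \<in> sets (word_measure N)"
    unfolding C word_measure_def
    by (rule sets_PiM_I) (auto simp: sets_uniform_count_measure lt)
  have "emeasure (word_measure N) C = (\<Prod>i<n. emeasure (uniform_count_measure {..<N}) {w ! i})"
    unfolding C word_measure_def
    by (rule emeasure_PiM_emb) (auto simp: sets_uniform_count_measure lt)
  also have "\<dots> = (\<Prod>i<n. ennreal (1 / real N))"
    by (intro prod.cong refl) (simp add: emeasure_uniform_count_measure lt)
  also have "\<dots> = ennreal (1 / real N ^ n)"
    by (simp add: ennreal_power power_one_over)
  finally show "emeasure (word_measure N) C = ennreal (1 / real N ^ n)" .
qed

text \<open>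
  The hypothesis says that the sum has finite expectation: every word of length \<open>n\<close> has probability
  \<open>1 / N ^ n\<close>.
\<close>

lemma AE_summable_along_words:
  fixes g :: "nat list \<Rightarrow> real"
  assumes "N > 0" and nonneg: "\<And>w. g w \<ge> 0"
    and summable: "summable (\<lambda>n. (\<Sum>w\<in>words N n. g w) / real N ^ n)"
  shows "AE \<omega> in word_measure N. summable (\<lambda>n. g (map \<omega> [0..<n]))"
proof -
  define C where "C n w = {\<omega> \<in> space (word_measure N). map \<omega> [0..<n] = w}" for n w
  define F where "F n \<omega> = (\<Sum>w\<in>words N n. ennreal (g w) * indicator (C n w) \<omega>)" for n \<omega>
  have C: "C n w \<in> sets (word_measure N)" "emeasure (word_measure N) (C n w) = ennreal (1 / real N ^ n)"
    if "w \<in> words N n" for n w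
    using cylinder_word_measure[OF assms(1) that] by (simp_all add: C_def)
  have F: "F n \<omega> = ennreal (g (map \<omega> [0..<n]))" if "\<omega> \<in> space (word_measure N)" for n \<omega>
  proof -
    have "map \<omega> [0..<n] \<in> words N n"
      using that by (auto simp: space_word_measure words_def)
    moreover have "F n \<omega> = (\<Sum>w\<in>words N n. if w = map \<omega> [0..<n] then ennreal (g w) else 0)"
      unfolding F_def using that by (intro sum.cong) (auto simp: C_def indicator_def)
    ultimately show ?thesis
      by simp
  qed
  have Fm: "F n \<in> borel_measurable (word_measure N)" for n
    unfolding F_def using C by (intro borel_measurable_sum) auto
  have int: "(\<integral>\<^sup>+\<omega>. F n \<omega> \<partial>word_measure N) = ennreal ((\<Sum>w\<in>words N n. g w) / real N ^ n)" for n
  proof -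
    have "(\<integral>\<^sup>+\<omega>. F n \<omega> \<partial>word_measure N) =
        (\<Sum>w\<in>words N n. \<integral>\<^sup>+\<omega>. ennreal (g w) * indicator (C n w) \<omega> \<partial>word_measure N)"
      unfolding F_def using C by (intro nn_integral_sum) auto
    also have "\<dots> = (\<Sum>w\<in>words N n. ennreal (g w) * ennreal (1 / real N ^ n))"
      using C by (intro sum.cong refl) (simp add: nn_integral_cmult_indicator)
    also have "\<dots> = (\<Sum>w\<in>words N n. ennreal (g w * (1 / real N ^ n)))"
      by (intro sum.cong refl ennreal_mult[symmetric]) (auto simp: nonneg)
    also have "\<dots> = ennreal (\<Sum>w\<in>words N n. g w * (1 / real N ^ n))"
      by (intro sum_ennreal) (simp add: nonneg)
    finally show ?thesis
      by (simp add: sum_divide_distrib)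
  qed
  have "(\<integral>\<^sup>+\<omega>. (\<Sum>n. F n \<omega>) \<partial>word_measure N) = (\<Sum>n. \<integral>\<^sup>+\<omega>. F n \<omega> \<partial>word_measure N)"
    by (intro nn_integral_suminf Fm)
  also have "\<dots> = ennreal (\<Sum>n. (\<Sum>w\<in>words N n. g w) / real N ^ n)"
    unfolding int by (intro suminf_ennreal2 summable divide_nonneg_nonneg sum_nonneg nonneg) auto
  finally have "AE \<omega> in word_measure N. (\<Sum>n. F n \<omega>) \<noteq> \<infinity>"
    using Fm by (intro nn_integral_PInf_AE borel_measurable_suminf) auto
  with AE_space show ?thesis
  proof eventually_elim
    fix \<omega> assume "\<omega> \<in> space (word_measure N)" "(\<Sum>n. F n \<omega>) \<noteq> \<infinity>"
    then show "summable (\<lambda>n. g (map \<omega> [0..<n]))"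
      by (intro summable_suminf_not_top nonneg) (simp add: F)
  qed
qed

section \<open>The gradient\<close>

context gasket
begin

text \<open>
  The vector of boundary values that represents the \<open>n\<close>-th approximation of the gradient.
\<close>

definition pulled_back :: "('a \<Rightarrow> real) \<Rightarrow> (nat \<Rightarrow> nat) \<Rightarrow> nat \<Rightarrow> nat \<Rightarrow> real" where
  "pulled_back u \<omega> n = word_ext_inv N (map \<omega> [0..<n]) (cell_vals u (map \<omega> [0..<n]))"

text \<open>
  One step of the approximation replaces the harmonic extension of \<open>u\<close> on the cell by the values of \<open>u\<close>
  on the next smaller cell, and then pulls back along the longer word. The change is the
  pull-back of the defect.
\<close>

lemma gradient_increment_le:
  assumes \<mu>: "standard_bernoulli N p \<mu>" and lap: "has_laplacian N p \<mu> u f"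
    and M: "\<And>x. x \<in> K \<Longrightarrow> \<bar>f x\<bar> \<le> M"
    and \<omega>: "\<And>k. \<omega> k < N"
  shows "sqn (\<lambda>j. pulled_back u \<omega> (Suc n) j - pulled_back u \<omega> n j)
    \<le> real N * (M / (real N + 2) ^ n)\<^sup>2 * growth N (map \<omega> [0..<Suc n])"
proof -
  define w where "w = map \<omega> [0..<n]"
  define i where "i = \<omega> n"
  have w: "w \<in> words N n" "w @ [i] \<in> words N (Suc n)" and i: "i < N" and Suc: "map \<omega> [0..<Suc n] = w @ [i]"
    using prefix_in_words[of \<omega> n, OF \<omega>] prefix_in_words[of \<omega> "Suc n", OF \<omega>] \<omega> by (auto simp: w_def i_def)
  define d where "d j = cell_vals u (w @ [i]) j - cell_ext N i (cell_vals u w) j" for j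
  have "word_ext_inv N (w @ [i]) (cell_ext N i (cell_vals u w)) = word_ext_inv N w (cell_vals u w)"
    by (simp add: word_ext_inv_append cell_ext_inv_cell_ext i)
  then have "word_ext_inv N (w @ [i]) d =
      (\<lambda>j. pulled_back u \<omega> (Suc n) j - pulled_back u \<omega> n j)"
    using word_ext_inv_linear[of N "w @ [i]" 1 "cell_vals u (w @ [i])" "-1" "cell_ext N i (cell_vals u w)"]
    unfolding pulled_back_def Suc w_def[symmetric] by (simp add: d_def[abs_def])
  moreover have "\<bar>d j\<bar> \<le> M / (real N + 2) ^ n" if "j < N" for j
    unfolding d_def by (rule harmonic_defect_le[OF \<mu> lap M w(1) i that])
  ultimately show ?thesis
    using form0_word_ext_inv_le[OF w(2), of d] by (simp only: Suc)
qed

text \<open>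
  The powers of \<open>N + 2\<close> in the defect and in the norm of the inverse cancel. The additional factor
  \<open>1 / s ^ n\<close> allows passing from square norms to norms by the inequality of arithmetic and geometric
  means, \<open>sqrt (a * s ^ n) \<le> (a + s ^ n) / 2\<close>.
\<close>

lemma gradient_defined_if_growth_summable:
  assumes \<mu>: "standard_bernoulli N p \<mu>" and lap: "has_laplacian N p \<mu> u f"
    and \<omega>: "\<And>k. \<omega> k < N" and s: "0 < s" "s < 1"
    and summable: "summable (\<lambda>n. growth N (map \<omega> [0..<n]) / ((real N + 2)\<^sup>2 * s) ^ n)"
  shows "gradient_defined N p u \<omega>"
proof -
  have "continuous_on K (\<lambda>x. \<bar>f x\<bar>)"
    using lap by (intro continuous_intros) (simp add: has_laplacian_def)
  then obtain x where x: "x \<in> K" "\<And>y. y \<in> K \<Longrightarrow> \<bar>f y\<bar> \<le> \<bar>f x\<bar>"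
    using continuous_attains_sup[OF gasket_K(2,1)] by blast
  define M where "M = \<bar>f x\<bar>"
  have M: "M \<ge> 0" "\<And>y. y \<in> K \<Longrightarrow> \<bar>f y\<bar> \<le> M"
    using x by (auto simp: M_def)
  define a where "a n = growth N (map \<omega> [0..<n]) / ((real N + 2)\<^sup>2 * s) ^ n" for n
  define C where "C = sqrt (real N) * M * (real N + 2)"
  have a: "a n \<ge> 0" for n
    using s by (simp add: a_def growth_nonneg)
  have N2: "real N + 2 > 0"
    using N_pos by linarith
  have le: "sqrt (sqn (\<lambda>j. pulled_back u \<omega> (Suc n) j - pulled_back u \<omega> n j))
      \<le> C * ((a (Suc n) + s ^ Suc n) / 2)" for n
  proof -
    have "growth N (map \<omega> [0..<Suc n]) = ((real N + 2)\<^sup>2 * s) ^ Suc n * a (Suc n)"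
      using N2 s by (simp add: a_def)
    then have "real N * (M / (real N + 2) ^ n)\<^sup>2 * growth N (map \<omega> [0..<Suc n])
        = real N * M\<^sup>2 / ((real N + 2)\<^sup>2) ^ n * (((real N + 2)\<^sup>2) ^ Suc n * s ^ Suc n * a (Suc n))"
      by (simp only: power_mult_distrib power_divide power_mult[symmetric] mult.commute[of n 2]
          times_divide_eq_right)
    also have "\<dots> = real N * M\<^sup>2 * (real N + 2)\<^sup>2 * (a (Suc n) * s ^ Suc n)"
      using N2 by simp
    also have "\<dots> = C\<^sup>2 * (a (Suc n) * s ^ Suc n)"
      by (simp add: C_def power_mult_distrib)
    finally have eq: "real N * (M / (real N + 2) ^ n)\<^sup>2 * growth N (map \<omega> [0..<Suc n])
        = C\<^sup>2 * (a (Suc n) * s ^ Suc n)" .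
    have "sqn (\<lambda>j. pulled_back u \<omega> (Suc n) j - pulled_back u \<omega> n j)
        \<le> C\<^sup>2 * (a (Suc n) * s ^ Suc n)"
      unfolding eq[symmetric] using M(2) \<omega> by (rule gradient_increment_le[OF \<mu> lap])
    then have "sqrt (sqn (\<lambda>j. pulled_back u \<omega> (Suc n) j - pulled_back u \<omega> n j))
        \<le> sqrt (C\<^sup>2 * (a (Suc n) * s ^ Suc n))"
      by (rule real_sqrt_le_mono)
    also have "\<dots> = C * sqrt (a (Suc n) * s ^ Suc n)"
      using M N2 by (simp add: real_sqrt_mult C_def)
    also have "\<dots> \<le> C * ((a (Suc n) + s ^ Suc n) / 2)"
      using M N2 a s by (intro mult_left_mono arith_geo_mean_sqrt) (auto simp: C_def)
    finally show ?thesis .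
  qed
  have "summable (\<lambda>n. C * ((a (Suc n) + s ^ Suc n) / 2))"
  proof (intro summable_mult summable_divide summable_add)
    show "summable (\<lambda>n. a (Suc n))"
      using summable unfolding a_def[symmetric] by (simp only: summable_Suc_iff)
    show "summable (\<lambda>n. s ^ Suc n)"
      using s by (simp only: summable_Suc_iff) (simp add: summable_geometric)
  qed
  then have "summable (\<lambda>n. sqrt (sqn (\<lambda>j. pulled_back u \<omega> (Suc n) j - pulled_back u \<omega> n j)))"
    by (rule summable_comparison_test') (use le form0_nonneg in auto)
  then show ?thesis
    using \<omega> by (intro gradient_defined_if_summable[of \<omega> u "pulled_back u \<omega>"])
      (simp_all add: grad_n_eq pulled_back_def)
qed

text \<open>
  The expectation of \<open>growth N w / (N + 2) ^ (2 * n)\<close> is a multiple of \<open>\<theta> ^ n\<close> with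
  \<open>\<theta> = (N\<^sup>2 - N - 1) / N\<^sup>2 < 1\<close>. With \<open>s = sqrt \<theta>\<close>, the division by \<open>s ^ n\<close> leaves the convergent
  series of the powers of \<open>s\<close>.
\<close>

lemma AE_growth_summable:
  obtains s where "0 < s" "s < 1"
    "AE \<omega> in word_measure N. summable (\<lambda>n. growth N (map \<omega> [0..<n]) / ((real N + 2)\<^sup>2 * s) ^ n)"
proof
  define \<theta> where "\<theta> = ((real N)\<^sup>2 - real N - 1) / (real N)\<^sup>2"
  define s where "s = sqrt \<theta>"
  have "real N * real N \<ge> 2 * real N" "real N \<ge> 2"
    using N_ge_2 by (auto intro: mult_right_mono)
  then have num: "0 < (real N)\<^sup>2 - real N - 1" "(real N)\<^sup>2 - real N - 1 < (real N)\<^sup>2"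
    unfolding power2_eq_square by linarith+
  then have \<theta>: "0 < \<theta>" "\<theta> < 1"
    using N_pos by (auto simp: \<theta>_def)
  show s: "0 < s" "s < 1"
    using \<theta> by (auto simp: s_def)
  have ss: "s * s = \<theta>"
    using \<theta> by (simp add: s_def)
  define g where "g w = growth N w / ((real N + 2)\<^sup>2 * s) ^ length w" for w
  have "(\<Sum>w\<in>words N n. g w) / real N ^ n = growth N [] * s ^ n" for n
  proof -
    have N2: "(real N + 2)\<^sup>2 * s > 0"
      using s by (intro mult_pos_pos) auto
    have "(\<Sum>w\<in>words N n. g w) = (\<Sum>w\<in>words N n. growth N w / ((real N + 2)\<^sup>2 * s) ^ n)"
      by (intro sum.cong) (auto simp: g_def words_def)
    also have "\<dots> = ((real N + 2)\<^sup>2 * ((real N)\<^sup>2 - real N - 1) / real N) ^ n * growth N []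
        / ((real N + 2)\<^sup>2 * s) ^ n"
      unfolding sum_divide_distrib[symmetric] sum_growth[OF N_pos(1)] ..
    also have "(real N + 2)\<^sup>2 * ((real N)\<^sup>2 - real N - 1) / real N = (real N + 2)\<^sup>2 * s * (s * real N)"
    proof -
      have "(real N)\<^sup>2 - real N - 1 = s * s * (real N)\<^sup>2"
        unfolding ss using N_pos by (simp add: \<theta>_def)
      then have "((real N)\<^sup>2 - real N - 1) / real N = s * (s * real N)"
        using N_pos by (simp add: power2_eq_square)
      then show ?thesis
        by (simp only: times_divide_eq_right[symmetric] mult.assoc)
    qed
    also have "\<dots> ^ n * growth N [] / ((real N + 2)\<^sup>2 * s) ^ n = s ^ n * real N ^ n * growth N []"
      using N2 by (simp add: power_mult_distrib)
    finally show ?thesis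
      using N_pos by simp
  qed
  then have "summable (\<lambda>n. (\<Sum>w\<in>words N n. g w) / real N ^ n)"
    using s by (simp add: summable_mult summable_geometric)
  moreover have "g w \<ge> 0" for w
    using s by (simp add: g_def growth_nonneg)
  ultimately have "AE \<omega> in word_measure N. summable (\<lambda>n. g (map \<omega> [0..<n]))"
    using N_pos by (intro AE_summable_along_words)
  then show "AE \<omega> in word_measure N. summable (\<lambda>n. growth N (map \<omega> [0..<n]) / ((real N + 2)\<^sup>2 * s) ^ n)"
    by (simp add: g_def)
qed

end

theorem theorem5p7:
  fixes N :: nat
    and p :: "nat \<Rightarrow> 'a::euclidean_space"
    and \<mu> :: "'a measure"
    and u :: "'a \<Rightarrow> real"
  assumes "N \<ge> 3"
    and "regular_simplex N p"
    and "standard_bernoulli N p \<mu>"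
    and "u \<in> dom_laplacian N p \<mu>"
  shows "AE \<omega> in word_measure N. gradient_defined N p u \<omega>"
proof -
  interpret gasket N p
    using assms(1,2) by unfold_locales auto
  obtain f where f: "has_laplacian N p \<mu> u f"
    using assms(4) by (auto simp: dom_laplacian_def)
  from AE_growth_summable obtain s where s: "0 < s" "s < 1"
    "AE \<omega> in word_measure N. summable (\<lambda>n. growth N (map \<omega> [0..<n]) / ((real N + 2)\<^sup>2 * s) ^ n)" .
  from AE_space s(3) show ?thesis
  proof eventually_elim
    fix \<omega> assume "\<omega> \<in> space (word_measure N)"
    then have "\<omega> k < N" for k
      by (auto simp: space_word_measure)
    moreover assume "summable (\<lambda>n. growth N (map \<omega> [0..<n]) / ((real N + 2)\<^sup>2 * s) ^ n)"
    ultimately show "gradient_defined N p u \<omega>"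
      using gradient_defined_if_growth_summable[OF assms(3) f] s(1,2) by blast
  qed
qed

end
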